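(* Let $\mathbf{K}$ be a $\mu$-AEC admitting intersections. (1) In $\mathbf{K}$, presentability ranks that are greater than or equal to $\mu$ are successors; that is, for every $M\in\mathbf{K}$, if $r_{\mathbf{K}}(M)\ge\mu$, then $r_{\mathbf{K}}(M)$ is a successor cardinal. (2) If $\mathbf{K}$ has arbitrarily large models, then $\mathbf{K}$ has objects of all regular internal sizes greater than or equal to $\mu$; that is, for every regular cardinal $\lambda\ge\mu$ there is $M\in\mathbf{K}$ with $|M|_{\mathbf{K}}=\lambda$. In particular, $\mathbf{K}$ is weakly LS-accessible.
   Context: Let $\mu$ be a regular infinite cardinal. A ($\mu$-ary) abstract class is a pair $\mathbf{K}=(K,\le_{\mathbf{K}})$ where $K$ is a class of structures in a fixed $\mu$-ary vocabulary $\tau=\tau(\mathbf{K})$ (symbols have arity $<\mu$), and $\le_{\mathbf{K}}$ is a partial order on $K$ that respects isomorphisms and extends the $\tau$-substructure relation. $UM$ denotes the universe of $M$. $\mathbf{K}$ is regarded as a category whose morphisms $f:M\to N$ are the $\mathbf{K}$-embeddings: isomorphisms of $M$ onto $f[M]$ with $f[M]\le_{\mathbf{K}}N$. An abstract class $\mathbf{K}$ is a $\mu$-AEC if: (i) Coherence: if $M_0,M_1,M_2\in\mathbf{K}$, $M_0\subseteq M_1\le_{\mathbf{K}}M_2$ and $M_0\le_{\mathbf{K}}M_2$, then $M_0\le_{\mathbf{K}}M_1$. (ii) Chain axioms: if $\langle M_i:i\in I\rangle$ is a $\mu$-directed system in $\mathbf{K}$, then $M:=\bigcup_{i\in I} M_i\in\mathbf{K}$,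 $M_i\le_{\mathbf{K}}M$ for all $i\in I$, and if $M_i\le_{\mathbf{K}}N$ for all $i\in I$ then $M\le_{\mathbf{K}}N$. (iii) Löwenheim–Skolem–Tarski: there is a cardinal $\lambda=\lambda^{<\mu}\ge|\tau(\mathbf{K})|+\mu$ such that for all $M\in\mathbf{K}$ and $A\subseteq UM$ there is $M_0\in\mathbf{K}$ with $M_0\le_{\mathbf{K}}M$, $A\subseteq UM_0$ and $|UM_0|\le|A|^{<\mu}+\lambda$. $\mathbf{K}$ has arbitrarily large models if the cardinalities $|UM|$, $M\in\mathbf{K}$, are unbounded. $\mathbf{K}$ admits intersections if for any $N\in\mathbf{K}$ and $A\subseteq UN$, the set $\mathrm{cl}^N(A):=\bigcap\{UM: M\in\mathbf{K},\ M\le_{\mathbf{K}}N,\ A\subseteq UM\}$ is the universe of a $\le_{\mathbf{K}}$-substructure of $N$. For regular $\lambda$, an object $M$ of a category is $\lambda$-presentable if its covariant hom-functor preserves colimits indexed by $\lambda$-directed posets (posets in which every subset of size $<\lambda$ has an upper bound). The presentability rank $r_{\mathbf{K}}(M)$ is the least regular cardinal $\lambda$ such that $M$ is $\lambda$-presentable in the category $\mathbf{K}$. The internal size is $|M|_{\mathbf{K}}:=\chi$ if $r_{\mathbf{K}}(M)=\chi^+$, and $|M|_{\mathbf{K}}:=r_{\mathbf{K}}(M)$ if $r_{\mathbf{K}}(M)$ is a limit cardinal. A category is weakly LS-accessible if there is a cardinal $\lambda$ such that for every regular $\lambda'\ge\lambda$ it contains an object of internal size exactly $\lambda'$.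
   Formalization: In (1) the case r_K(M) = μ with μ not a successor is excepted, since the claim fails there (μ = ℵ₀, K = all sets under inclusion, M a one-point set: rank ℵ₀). Sets and classes are taken relative to a universe of inaccessible cardinality. *)

theory Defs
  imports Main "HOL-Library.FuncSet"
begin

unbundle cardinal_syntax

section \<open>Cardinals of the ambient universe\<close>

text \<open>
  The type 'u plays the role of the set-theoretic universe. Under the hypothesis
  \<open>inaccessible |UNIV :: 'u set|\<close>, its subsets of size \<open><o |UNIV|\<close> are, up to bijection, the sets
  of a Grothendieck universe, while arbitrary collections of objects built from 'u are classes.
  Cardinals are, as in Main, well-order relations considered up to \<open>=o\<close>.
\<close>

definition inaccessible :: "'a rel \<Rightarrow> bool" where
  "inaccessible \<kappa> \<longleftrightarrow> Cinfinite \<kappa> \<and> natLeq <o \<kappa> \<and> regularCard \<kappa> \<and>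
     (\<forall>A \<subseteq> Field \<kappa>. |A| <o \<kappa> \<longrightarrow> |Pow A| <o \<kappa>)"

definition small :: "'u set \<Rightarrow> bool" where
  "small A \<longleftrightarrow> |A| <o |UNIV :: 'u set|"

definition cardinal :: "'u rel \<Rightarrow> bool" where
  "cardinal \<kappa> \<longleftrightarrow> Card_order \<kappa> \<and> \<kappa> <o |UNIV :: 'u set|"

definition regular_cardinal :: "'u rel \<Rightarrow> bool" where
  "regular_cardinal \<kappa> \<longleftrightarrow> cardinal \<kappa> \<and> cinfinite \<kappa> \<and> regularCard \<kappa>"

definition successor_cardinal :: "'u rel \<Rightarrow> bool" where
  "successor_cardinal \<kappa> \<longleftrightarrow> (\<exists>\<chi> :: 'u rel. cardinal \<chi> \<and> \<kappa> =o cardSuc \<chi>)"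

text \<open>
  \<open>\<kappa>\<^bsup><\<mu>\<^esup>\<close> as the cardinality of the set of sequences in \<open>\<kappa>\<close> of length less than \<open>\<mu>\<close>. For infinite
  \<open>\<mu>\<close> this is the supremum of the \<open>\<kappa>\<^bsup>\<nu>\<^esup>\<close> with \<open>\<nu> < \<mu>\<close>, except that for \<open>\<kappa> \<le> 1\<close> it may be as large
  as \<open>\<mu>\<close>; below it occurs only for \<open>\<kappa> \<ge> \<mu>\<close> or added to a cardinal \<open>\<ge> \<mu>\<close>, where this makes no
  difference.
\<close>

definition power_less :: "'a rel \<Rightarrow> 'b rel \<Rightarrow> ('b \<times> ('b \<Rightarrow> 'a)) rel" where
  "power_less \<kappa> \<mu> = |SIGMA \<alpha> : Field \<mu>. underS \<mu> \<alpha> \<rightarrow>\<^sub>E Field \<kappa>|"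

definition directed_poset :: "'u rel \<Rightarrow> 'u set \<Rightarrow> 'u rel \<Rightarrow> bool" where
  "directed_poset \<theta> I r \<longleftrightarrow> small I \<and> partial_order_on I r \<and>
     (\<forall>X \<subseteq> I. |X| <o \<theta> \<longrightarrow> (\<exists>u \<in> I. \<forall>x \<in> X. (x, u) \<in> r))"


section \<open>Structures in an infinitary vocabulary\<close>

text \<open>
  The arity of a symbol is given by a set of argument positions; the tuples of arity \<open>P\<close> in \<open>U\<close>
  are the functions \<open>P \<rightarrow>\<^sub>E U\<close>.
\<close>

record ('s, 'u) vocabulary =
  funs :: "'s set"
  rels :: "'s set"
  arity :: "'s \<Rightarrow> 'u set"

definition is_vocabulary :: "'u rel \<Rightarrow> ('s, 'u) vocabulary \<Rightarrow> bool" where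
  "is_vocabulary \<mu> \<tau> \<longleftrightarrow> funs \<tau> \<inter> rels \<tau> = {} \<and> |funs \<tau> \<union> rels \<tau>| <o |UNIV :: 'u set| \<and>
     (\<forall>s \<in> funs \<tau> \<union> rels \<tau>. |arity \<tau> s| <o \<mu>)"

record ('s, 'u) struct =
  univ :: "'u set"
  fun_int :: "'s \<Rightarrow> ('u \<Rightarrow> 'u) \<Rightarrow> 'u"
  rel_int :: "'s \<Rightarrow> ('u \<Rightarrow> 'u) set"

text \<open>
  Interpretations are pinned down outside their domains, so that structures with the same
  universe and the same interpretations are equal.
\<close>

definition is_structure :: "('s, 'u) vocabulary \<Rightarrow> ('s, 'u) struct \<Rightarrow> bool" where
  "is_structure \<tau> M \<longleftrightarrow> small (univ M) \<and>
     (\<forall>s \<in> funs \<tau>. fun_int M s \<in> (arity \<tau> s \<rightarrow>\<^sub>E univ M) \<rightarrow>\<^sub>E univ M) \<and>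
     (\<forall>s. s \<notin> funs \<tau> \<longrightarrow> fun_int M s = (\<lambda>_. undefined)) \<and>
     (\<forall>s \<in> rels \<tau>. rel_int M s \<subseteq> arity \<tau> s \<rightarrow>\<^sub>E univ M) \<and>
     (\<forall>s. s \<notin> rels \<tau> \<longrightarrow> rel_int M s = {})"

definition substructure :: "('s, 'u) vocabulary \<Rightarrow> ('s, 'u) struct \<Rightarrow> ('s, 'u) struct \<Rightarrow> bool" where
  "substructure \<tau> M N \<longleftrightarrow> is_structure \<tau> M \<and> is_structure \<tau> N \<and> univ M \<subseteq> univ N \<and>
     (\<forall>s \<in> funs \<tau>. \<forall>t \<in> arity \<tau> s \<rightarrow>\<^sub>E univ M. fun_int M s t = fun_int N s t) \<and>
     (\<forall>s \<in> rels \<tau>. \<forall>t \<in> arity \<tau> s \<rightarrow>\<^sub>E univ M. t \<in> rel_int M s \<longleftrightarrow> t \<in> rel_int N s)"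

definition iso :: "('s, 'u) vocabulary \<Rightarrow> ('u \<Rightarrow> 'u) \<Rightarrow> ('s, 'u) struct \<Rightarrow> ('s, 'u) struct \<Rightarrow> bool" where
  "iso \<tau> f M N \<longleftrightarrow> is_structure \<tau> M \<and> is_structure \<tau> N \<and> bij_betw f (univ M) (univ N) \<and>
     (\<forall>s \<in> funs \<tau>. \<forall>t \<in> arity \<tau> s \<rightarrow>\<^sub>E univ M.
        f (fun_int M s t) = fun_int N s (compose (arity \<tau> s) f t)) \<and>
     (\<forall>s \<in> rels \<tau>. \<forall>t \<in> arity \<tau> s \<rightarrow>\<^sub>E univ M.
        t \<in> rel_int M s \<longleftrightarrow> compose (arity \<tau> s) f t \<in> rel_int N s)"

definition union_struct ::
  "('s, 'u) vocabulary \<Rightarrow> 'i set \<Rightarrow> ('i \<Rightarrow> ('s, 'u) struct) \<Rightarrow> ('s, 'u) struct" where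
  "union_struct \<tau> I M =
     \<lparr>univ = (\<Union>i \<in> I. univ (M i)),
      fun_int = (\<lambda>s. if s \<in> funs \<tau>
        then (\<lambda>t \<in> arity \<tau> s \<rightarrow>\<^sub>E (\<Union>i \<in> I. univ (M i)).
                THE y. \<exists>i \<in> I. t \<in> arity \<tau> s \<rightarrow>\<^sub>E univ (M i) \<and> y = fun_int (M i) s t)
        else (\<lambda>_. undefined)),
      rel_int = (\<lambda>s. \<Union>i \<in> I. rel_int (M i) s)\<rparr>"


section \<open>Abstract classes and \<open>\<mu>\<close>-AECs\<close>

record ('s, 'u) aclass =
  voc :: "('s, 'u) vocabulary"
  models :: "('s, 'u) struct set"
  le :: "('s, 'u) struct rel"

definition abstract_class :: "'u rel \<Rightarrow> ('s, 'u) aclass \<Rightarrow> bool" where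
  "abstract_class \<mu> K \<longleftrightarrow>
     is_vocabulary \<mu> (voc K) \<and>
     (\<forall>M \<in> models K. is_structure (voc K) M) \<and>
     (\<forall>M N f. M \<in> models K \<and> iso (voc K) f M N \<longrightarrow> N \<in> models K) \<and>
     partial_order_on (models K) (le K) \<and>
     (\<forall>M N M' N' f. (M, N) \<in> le K \<and> iso (voc K) f N N' \<and> iso (voc K) f M M' \<longrightarrow> (M', N') \<in> le K) \<and>
     (\<forall>M N. (M, N) \<in> le K \<longrightarrow> substructure (voc K) M N)"

definition coherence :: "('s, 'u) aclass \<Rightarrow> bool" where
  "coherence K \<longleftrightarrow> (\<forall>M0 \<in> models K. \<forall>M1 \<in> models K. \<forall>M2 \<in> models K.
     substructure (voc K) M0 M1 \<and> (M1, M2) \<in> le K \<and> (M0, M2) \<in> le K \<longrightarrow> (M0, M1) \<in> le K)"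

definition directed_system ::
  "'u rel \<Rightarrow> ('s, 'u) aclass \<Rightarrow> 'u set \<Rightarrow> 'u rel \<Rightarrow> ('u \<Rightarrow> ('s, 'u) struct) \<Rightarrow> bool" where
  "directed_system \<mu> K I r M \<longleftrightarrow> directed_poset \<mu> I r \<and> (\<forall>i \<in> I. M i \<in> models K) \<and>
     (\<forall>i j. (i, j) \<in> r \<longrightarrow> (M i, M j) \<in> le K)"

definition chain_axioms :: "'u rel \<Rightarrow> ('s, 'u) aclass \<Rightarrow> bool" where
  "chain_axioms \<mu> K \<longleftrightarrow> (\<forall>I r M. directed_system \<mu> K I r M \<longrightarrow>
     union_struct (voc K) I M \<in> models K \<and>
     (\<forall>i \<in> I. (M i, union_struct (voc K) I M) \<in> le K) \<and>
     (\<forall>N \<in> models K. (\<forall>i \<in> I. (M i, N) \<in> le K) \<longrightarrow> (union_struct (voc K) I M, N) \<in> le K))"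

definition LST_axiom :: "'u rel \<Rightarrow> ('s, 'u) aclass \<Rightarrow> bool" where
  "LST_axiom \<mu> K \<longleftrightarrow> (\<exists>\<theta> :: 'u rel. cardinal \<theta> \<and> \<theta> =o power_less \<theta> \<mu> \<and>
     |funs (voc K) \<union> rels (voc K)| +c \<mu> \<le>o \<theta> \<and>
     (\<forall>M \<in> models K. \<forall>A \<subseteq> univ M. \<exists>M0 \<in> models K. (M0, M) \<in> le K \<and> A \<subseteq> univ M0 \<and>
        |univ M0| \<le>o power_less |A| \<mu> +c \<theta>))"

definition mu_AEC :: "'u rel \<Rightarrow> ('s, 'u) aclass \<Rightarrow> bool" where
  "mu_AEC \<mu> K \<longleftrightarrow> abstract_class \<mu> K \<and> coherence K \<and> chain_axioms \<mu> K \<and> LST_axiom \<mu> K"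

definition arbitrarily_large_models :: "('s, 'u) aclass \<Rightarrow> bool" where
  "arbitrarily_large_models K \<longleftrightarrow>
     (\<forall>\<kappa> :: 'u rel. cardinal \<kappa> \<longrightarrow> (\<exists>M \<in> models K. \<kappa> \<le>o |univ M| ))"

definition cl :: "('s, 'u) aclass \<Rightarrow> ('s, 'u) struct \<Rightarrow> 'u set \<Rightarrow> 'u set" where
  "cl K N A = \<Inter> {univ M | M. M \<in> models K \<and> (M, N) \<in> le K \<and> A \<subseteq> univ M}"

definition admits_intersections :: "('s, 'u) aclass \<Rightarrow> bool" where
  "admits_intersections K \<longleftrightarrow>
     (\<forall>N \<in> models K. \<forall>A \<subseteq> univ N. \<exists>M. (M, N) \<in> le K \<and> univ M = cl K N A)"


section \<open>Presentability in concrete categories\<close>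

text \<open>
  Categories whose morphisms are functions between carrier sets (undefined outside the carrier of
  the source); composition is \<^const>\<open>compose\<close> and identities are identity functions.
\<close>

record ('o, 'e) concrete_cat =
  obj :: "'o set"
  carr :: "'o \<Rightarrow> 'e set"
  hom :: "'o \<Rightarrow> 'o \<Rightarrow> ('e \<Rightarrow> 'e) set"

definition diagram ::
  "('o, 'e) concrete_cat \<Rightarrow> 'i set \<Rightarrow> 'i rel \<Rightarrow> ('i \<Rightarrow> 'o) \<Rightarrow> ('i \<Rightarrow> 'i \<Rightarrow> 'e \<Rightarrow> 'e) \<Rightarrow> bool" where
  "diagram C I r D d \<longleftrightarrow>
     (\<forall>i \<in> I. D i \<in> obj C \<and> d i i = (\<lambda>x \<in> carr C (D i). x)) \<and>
     (\<forall>i j. (i, j) \<in> r \<longrightarrow> d i j \<in> hom C (D i) (D j)) \<and>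
     (\<forall>i j k. (i, j) \<in> r \<and> (j, k) \<in> r \<longrightarrow> d i k = compose (carr C (D i)) (d j k) (d i j))"

definition cocone ::
  "('o, 'e) concrete_cat \<Rightarrow> 'i set \<Rightarrow> 'i rel \<Rightarrow> ('i \<Rightarrow> 'o) \<Rightarrow> ('i \<Rightarrow> 'i \<Rightarrow> 'e \<Rightarrow> 'e) \<Rightarrow>
     'o \<Rightarrow> ('i \<Rightarrow> 'e \<Rightarrow> 'e) \<Rightarrow> bool" where
  "cocone C I r D d X c \<longleftrightarrow> X \<in> obj C \<and> (\<forall>i \<in> I. c i \<in> hom C (D i) X) \<and>
     (\<forall>i j. (i, j) \<in> r \<longrightarrow> c i = compose (carr C (D i)) (c j) (d i j))"

definition colimit ::
  "('o, 'e) concrete_cat \<Rightarrow> 'i set \<Rightarrow> 'i rel \<Rightarrow> ('i \<Rightarrow> 'o) \<Rightarrow> ('i \<Rightarrow> 'i \<Rightarrow> 'e \<Rightarrow> 'e) \<Rightarrow>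
     'o \<Rightarrow> ('i \<Rightarrow> 'e \<Rightarrow> 'e) \<Rightarrow> bool" where
  "colimit C I r D d X c \<longleftrightarrow> cocone C I r D d X c \<and>
     (\<forall>Y e. cocone C I r D d Y e \<longrightarrow>
        (\<exists>!h. h \<in> hom C X Y \<and> (\<forall>i \<in> I. e i = compose (carr C (D i)) h (c i))))"

definition set_cat :: "('x set, 'x) concrete_cat" where
  "set_cat = \<lparr>obj = UNIV, carr = (\<lambda>A. A), hom = (\<lambda>A B. A \<rightarrow>\<^sub>E B)\<rparr>"

text \<open>The action \<open>hom(M, D) \<rightarrow> hom(M, D')\<close> of the covariant hom-functor on \<open>g : D \<rightarrow> D'\<close>:\<close>

definition hom_map ::
  "('o, 'e) concrete_cat \<Rightarrow> 'o \<Rightarrow> 'o \<Rightarrow> ('e \<Rightarrow> 'e) \<Rightarrow> ('e \<Rightarrow> 'e) \<Rightarrow> ('e \<Rightarrow> 'e)" where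
  "hom_map C M D g = (\<lambda>f \<in> hom C M D. compose (carr C M) g f)"

definition presentable :: "('o, 'u) concrete_cat \<Rightarrow> 'u rel \<Rightarrow> 'o \<Rightarrow> bool" where
  "presentable C \<theta> M \<longleftrightarrow>
     (\<forall>(I :: 'u set) r D d X c. directed_poset \<theta> I r \<and> diagram C I r D d \<and> colimit C I r D d X c \<longrightarrow>
        colimit set_cat I r (\<lambda>i. hom C M (D i)) (\<lambda>i j. hom_map C M (D i) (d i j))
          (hom C M X) (\<lambda>i. hom_map C M (D i) (c i)))"

definition presentability_rank :: "('o, 'u) concrete_cat \<Rightarrow> 'o \<Rightarrow> 'u rel" where
  "presentability_rank C M = (SOME \<theta>. regular_cardinal \<theta> \<and> presentable C \<theta> M \<and>
     (\<forall>\<kappa>. regular_cardinal \<kappa> \<and> presentable C \<kappa> M \<longrightarrow> \<theta> \<le>o \<kappa>))"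

definition internal_size :: "('o, 'u) concrete_cat \<Rightarrow> 'o \<Rightarrow> 'u rel" where
  "internal_size C M =
     (if successor_cardinal (presentability_rank C M)
      then (SOME \<chi>. cardinal \<chi> \<and> presentability_rank C M =o cardSuc \<chi>)
      else presentability_rank C M)"

definition weakly_LS_accessible :: "('o, 'u) concrete_cat \<Rightarrow> bool" where
  "weakly_LS_accessible C \<longleftrightarrow> (\<exists>\<theta> :: 'u rel. cardinal \<theta> \<and>
     (\<forall>\<theta>' :: 'u rel. regular_cardinal \<theta>' \<and> \<theta> \<le>o \<theta>' \<longrightarrow> (\<exists>M \<in> obj C. internal_size C M =o \<theta>')))"


section \<open>The category of an abstract class\<close>

text \<open>In the definition of embeddings, \<open>M'\<close> is the image structure \<open>f[M]\<close>.\<close>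

definition embeddings :: "('s, 'u) aclass \<Rightarrow> ('s, 'u) struct \<Rightarrow> ('s, 'u) struct \<Rightarrow> ('u \<Rightarrow> 'u) set" where
  "embeddings K M N =
     {f \<in> extensional (univ M). \<exists>M'. iso (voc K) f M M' \<and> (M', N) \<in> le K}"

definition cat_of :: "('s, 'u) aclass \<Rightarrow> (('s, 'u) struct, 'u) concrete_cat" where
  "cat_of K = \<lparr>obj = models K, carr = univ, hom = embeddings K\<rparr>"

end

theory Submission
  imports Defs
begin

text \<open>
  For regular \<open>\<theta> \<ge> \<mu>\<close>, a model \<open>M\<close> is \<open>\<theta>\<close>-presentable iff \<open>M = cl\<^sup>M(A)\<close> for some \<open>A\<close> with \<open>|A| < \<theta>\<close>.
  If \<open>M\<close> is \<open>\<theta>\<close>-presentable, the identity of \<open>M\<close>, which is the \<open>\<theta>\<close>-directed union of the hulls of its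
  subsets of size \<open>< \<theta>\<close>, factors through one of these hulls. Conversely, an embedding of a model
  generated by \<open>A\<close> into a \<open>\<theta>\<close>-directed colimit sends \<open>A\<close>, hence its closure, into the image of
  one stage.

  A model generated by \<open>A\<close> is therefore presentable at \<open>\<mu>\<close> or at \<open>|A|\<^sup>+\<close>, whichever is larger, which
  excludes limit ranks above \<open>\<mu>\<close>. For the second part, take a model \<open>N\<close> so large that closures of
  subsets of size \<open>\<le> \<theta>\<close> are proper, choose \<open>a\<^sub>\<alpha> \<notin> cl\<^sup>N{a\<^sub>\<beta> | \<beta> < \<alpha>}\<close> for \<open>\<alpha> < \<theta>\<close>, and let \<open>M\<close> be the
  closure of all \<open>a\<^sub>\<alpha>\<close>. Any \<open>B \<subseteq> M\<close> with \<open>|B| < \<theta>\<close> lies in the closure of an initial segment, so \<open>M\<close> has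
  rank exactly \<open>\<theta>\<^sup>+\<close>.
\<close>

section \<open>Isomorphisms and image structures\<close>

text \<open>The witness for the image f[M] that \<open>embeddings\<close> asks for. It is sensible
  only for \<open>f\<close> injective on \<open>univ M\<close>, where \<open>inv_into\<close> undoes
  \<open>f\<close> on tuples. The values outside the vocabulary are the defaults that
  \<open>is_structure\<close> prescribes.\<close>

definition image_struct ::
  "('s, 'u) vocabulary \<Rightarrow> ('u \<Rightarrow> 'u) \<Rightarrow> ('s, 'u) struct \<Rightarrow> ('s, 'u) struct" where
  "image_struct \<tau> f M =
     \<lparr>univ = f ` univ M,
      fun_int = (\<lambda>s. if s \<in> funs \<tau>
        then (\<lambda>t \<in> arity \<tau> s \<rightarrow>\<^sub>E f ` univ M.
                f (fun_int M s (compose (arity \<tau> s) (inv_into (univ M) f) t)))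
        else (\<lambda>_. undefined)),
      rel_int = (\<lambda>s. if s \<in> rels \<tau> then compose (arity \<tau> s) f ` rel_int M s else {})\<rparr>"

section \<open>Tuples and their transport along functions\<close>

lemma compose_in_PiE: "t \<in> P \<rightarrow>\<^sub>E A \<Longrightarrow> f ` A \<subseteq> B \<Longrightarrow> compose P f t \<in> P \<rightarrow>\<^sub>E B"
  by (auto simp: compose_def)

lemma compose_cong_PiE:
  "t \<in> P \<rightarrow>\<^sub>E A \<Longrightarrow> (\<And>x. x \<in> A \<Longrightarrow> f x = g x) \<Longrightarrow> compose P f t = compose P g t"
  by (fastforce simp: compose_def fun_eq_iff PiE_iff)

lemma compose_id_PiE: "t \<in> P \<rightarrow>\<^sub>E A \<Longrightarrow> (\<And>x. x \<in> A \<Longrightarrow> f x = x) \<Longrightarrow> compose P f t = t"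
  by (force simp: compose_def fun_eq_iff PiE_iff extensional_def)

lemma compose_compose: "compose P g (compose P f t) = compose P (g \<circ> f) t"
  by (auto simp: compose_def)

lemma inj_on_compose_PiE: "inj_on f A \<Longrightarrow> inj_on (compose P f) (P \<rightarrow>\<^sub>E A)"
proof (rule inj_onI)
  fix t u assume f: "inj_on f A" and t: "t \<in> P \<rightarrow>\<^sub>E A" "u \<in> P \<rightarrow>\<^sub>E A"
    and eq: "compose P f t = compose P f u"
  have "compose P (inv_into A f) (compose P f t) = compose P (inv_into A f) (compose P f u)"
    using eq by simp
  then show "t = u"
    using f t by (simp add: compose_compose compose_id_PiE[of _ P A] inv_into_f_f)
qed

lemma fun_int_in_univ:
  "is_structure \<tau> M \<Longrightarrow> s \<in> funs \<tau> \<Longrightarrow> t \<in> arity \<tau> s \<rightarrow>\<^sub>E univ M \<Longrightarrow> fun_int M s t \<in> univ M"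
  by (rule PiE_mem[of "fun_int M s"]) (simp_all add: is_structure_def)

lemma small_image: "small A \<Longrightarrow> small (f ` A)" for A :: "'u set" and f :: "'u \<Rightarrow> 'u"
  unfolding small_def by (rule ordLeq_ordLess_trans[OF card_of_image])

lemma small_subset: "small B \<Longrightarrow> A \<subseteq> B \<Longrightarrow> small A"
  unfolding small_def by (rule ordLeq_ordLess_trans[OF card_of_mono1])

lemma iso_fun_int:
  "iso \<tau> f M N \<Longrightarrow> s \<in> funs \<tau> \<Longrightarrow> t \<in> arity \<tau> s \<rightarrow>\<^sub>E univ M \<Longrightarrow>
    f (fun_int M s t) = fun_int N s (compose (arity \<tau> s) f t)"
  unfolding iso_def by simp

lemma iso_rel_int:
  "iso \<tau> f M N \<Longrightarrow> s \<in> rels \<tau> \<Longrightarrow> t \<in> arity \<tau> s \<rightarrow>\<^sub>E univ M \<Longrightarrow>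
    t \<in> rel_int M s \<longleftrightarrow> compose (arity \<tau> s) f t \<in> rel_int N s"
  unfolding iso_def by simp

lemma substructure_fun_int:
  "substructure \<tau> M N \<Longrightarrow> s \<in> funs \<tau> \<Longrightarrow> t \<in> arity \<tau> s \<rightarrow>\<^sub>E univ M \<Longrightarrow>
    fun_int M s t = fun_int N s t"
  unfolding substructure_def by simp

lemma substructure_rel_int:
  "substructure \<tau> M N \<Longrightarrow> s \<in> rels \<tau> \<Longrightarrow> t \<in> arity \<tau> s \<rightarrow>\<^sub>E univ M \<Longrightarrow>
    t \<in> rel_int M s \<longleftrightarrow> t \<in> rel_int N s"
  unfolding substructure_def by simp

lemma iso_cong:
  assumes "iso \<tau> f M N" "\<And>x. x \<in> univ M \<Longrightarrow> f x = g x"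
  shows "iso \<tau> g M N"
proof -
  have sM: "is_structure \<tau> M" using assms(1) unfolding iso_def by blast
  have c: "compose P g t = compose P f t" if "t \<in> P \<rightarrow>\<^sub>E univ M" for t P
    by (rule compose_cong_PiE[OF that]) (simp add: assms(2))
  have "bij_betw g (univ M) (univ N)"
    using assms bij_betw_cong[of "univ M" f g "univ N"] unfolding iso_def by blast
  moreover have "g (fun_int M s t) = fun_int N s (compose (arity \<tau> s) g t)"
    if "s \<in> funs \<tau>" "t \<in> arity \<tau> s \<rightarrow>\<^sub>E univ M" for s t
    using iso_fun_int[OF assms(1) that] assms(2)[OF fun_int_in_univ[OF sM that]] c[OF that(2)] by simp
  moreover have "t \<in> rel_int M s \<longleftrightarrow> compose (arity \<tau> s) g t \<in> rel_int N s"
    if "s \<in> rels \<tau>" "t \<in> arity \<tau> s \<rightarrow>\<^sub>E univ M" for s t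
    using iso_rel_int[OF assms(1) that] c[OF that(2)] by simp
  ultimately show ?thesis
    using assms(1) unfolding iso_def by blast
qed

lemma iso_inv_into:
  assumes "iso \<tau> f M N"
  shows "iso \<tau> (inv_into (univ M) f) N M"
proof -
  let ?g = "inv_into (univ M) f"
  have b: "bij_betw f (univ M) (univ N)" and sM: "is_structure \<tau> M"
    using assms unfolding iso_def by auto
  have g: "bij_betw ?g (univ N) (univ M)" by (rule bij_betw_inv_into[OF b])
  have pull: "compose P ?g t \<in> P \<rightarrow>\<^sub>E univ M \<and> compose P f (compose P ?g t) = t"
    if "t \<in> P \<rightarrow>\<^sub>E univ N" for t P
    using that g b compose_in_PiE[OF that, of ?g "univ M"]
    by (simp add: compose_compose compose_id_PiE[OF that] bij_betw_def f_inv_into_f)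
  have "?g (fun_int N s t) = fun_int M s (compose (arity \<tau> s) ?g t)"
    if s: "s \<in> funs \<tau>" and t: "t \<in> arity \<tau> s \<rightarrow>\<^sub>E univ N" for s t
  proof -
    let ?u = "compose (arity \<tau> s) ?g t"
    have "f (fun_int M s ?u) = fun_int N s t"
      using iso_fun_int[OF assms s, of ?u] pull[OF t] by simp
    moreover have "fun_int M s ?u \<in> univ M"
      using pull[OF t] fun_int_in_univ[OF sM s] by blast
    ultimately show ?thesis using b by (metis bij_betw_def inv_into_f_f)
  qed
  moreover have "t \<in> rel_int N s \<longleftrightarrow> compose (arity \<tau> s) ?g t \<in> rel_int M s"
    if s: "s \<in> rels \<tau>" and t: "t \<in> arity \<tau> s \<rightarrow>\<^sub>E univ N" for s t
    using iso_rel_int[OF assms s, of "compose (arity \<tau> s) ?g t"] pull[OF t] by simp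
  ultimately show ?thesis using assms g unfolding iso_def by blast
qed

lemma iso_comp:
  assumes f: "iso \<tau> f M N" and g: "iso \<tau> g N P"
  shows "iso \<tau> (g \<circ> f) M P"
proof -
  have b: "bij_betw f (univ M) (univ N)" "bij_betw g (univ N) (univ P)"
    and sM: "is_structure \<tau> M" using f g unfolding iso_def by auto
  have push: "compose Q f t \<in> Q \<rightarrow>\<^sub>E univ N" if "t \<in> Q \<rightarrow>\<^sub>E univ M" for t Q
    using b by (intro compose_in_PiE[OF that]) (simp add: bij_betw_def)
  have "(g \<circ> f) (fun_int M s t) = fun_int P s (compose (arity \<tau> s) (g \<circ> f) t)"
    if s: "s \<in> funs \<tau>" and t: "t \<in> arity \<tau> s \<rightarrow>\<^sub>E univ M" for s t
    using iso_fun_int[OF f s t] iso_fun_int[OF g s push[OF t]] by (simp only: compose_compose comp_apply)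
  moreover have "t \<in> rel_int M s \<longleftrightarrow> compose (arity \<tau> s) (g \<circ> f) t \<in> rel_int P s"
    if s: "s \<in> rels \<tau>" and t: "t \<in> arity \<tau> s \<rightarrow>\<^sub>E univ M" for s t
    using iso_rel_int[OF f s t] iso_rel_int[OF g s push[OF t]] by (simp only: compose_compose)
  ultimately show ?thesis using f g bij_betw_trans[OF b] unfolding iso_def by blast
qed

lemma iso_id: "is_structure \<tau> M \<Longrightarrow> iso \<tau> (\<lambda>x. x) M M"
  unfolding iso_def
  by (simp add: bij_betw_def compose_id_PiE[of _ _ "univ M" "\<lambda>x. x"])

lemma univ_image_struct [simp]: "univ (image_struct \<tau> f M) = f ` univ M"
  by (simp add: image_struct_def)

lemma iso_image_struct:
  assumes sM: "is_structure \<tau> M" and inj: "inj_on f (univ M)"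
  shows "iso \<tau> f M (image_struct \<tau> f M)"
proof -
  let ?N = "image_struct \<tau> f M" and ?g = "inv_into (univ M) f"
  have retr: "compose P ?g (compose P f t) = t" if "t \<in> P \<rightarrow>\<^sub>E univ M" for t P
    using that inj by (simp add: compose_compose compose_id_PiE[OF that] inv_into_f_f)
  have pull: "compose P ?g t \<in> P \<rightarrow>\<^sub>E univ M" if "t \<in> P \<rightarrow>\<^sub>E f ` univ M" for t P
    using that inj by (intro compose_in_PiE) (auto simp: inv_into_f_f)
  have push: "compose P f t \<in> P \<rightarrow>\<^sub>E f ` univ M" if "t \<in> P \<rightarrow>\<^sub>E univ M" for t P
    using that by (intro compose_in_PiE) auto
  have relM: "rel_int M s \<subseteq> arity \<tau> s \<rightarrow>\<^sub>E univ M" if "s \<in> rels \<tau>" for s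
    using sM that unfolding is_structure_def by blast
  have "is_structure \<tau> ?N"
    unfolding is_structure_def
  proof (intro conjI ballI allI impI)
    show "small (univ ?N)" using sM small_image[of "univ M" f] unfolding is_structure_def by simp
  next
    fix s assume s: "s \<in> funs \<tau>"
    then have "f (fun_int M s (compose (arity \<tau> s) ?g t)) \<in> f ` univ M"
      if "t \<in> arity \<tau> s \<rightarrow>\<^sub>E f ` univ M" for t
      using fun_int_in_univ[OF sM s pull[OF that]] by blast
    then show "fun_int ?N s \<in> (arity \<tau> s \<rightarrow>\<^sub>E univ ?N) \<rightarrow>\<^sub>E univ ?N"
      unfolding univ_image_struct using s by (simp add: image_struct_def)
  next
    fix s assume "s \<in> rels \<tau>"
    then have "rel_int ?N s = compose (arity \<tau> s) f ` rel_int M s"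
      by (simp add: image_struct_def)
    then show "rel_int ?N s \<subseteq> arity \<tau> s \<rightarrow>\<^sub>E univ ?N"
      using subsetD[OF relM[OF \<open>s \<in> rels \<tau>\<close>]] by (simp only: univ_image_struct) (intro image_subsetI push)
  qed (simp_all add: image_struct_def)
  moreover have "f (fun_int M s t) = fun_int ?N s (compose (arity \<tau> s) f t)"
    if "s \<in> funs \<tau>" "t \<in> arity \<tau> s \<rightarrow>\<^sub>E univ M" for s t
    using that(1) push[OF that(2)] retr[OF that(2)] by (simp add: image_struct_def)
  \<comment> \<open>\<open>compose\<close> with \<open>f\<close> is injective on tuples over
    \<open>univ M\<close>, so no tuple outside the relation is sent into its image.\<close>
  moreover have "t \<in> rel_int M s \<longleftrightarrow> compose (arity \<tau> s) f t \<in> rel_int ?N s"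
    if s: "s \<in> rels \<tau>" and t: "t \<in> arity \<tau> s \<rightarrow>\<^sub>E univ M" for s t
    using s inj_on_image_mem_iff[OF inj_on_compose_PiE[OF inj] t relM[OF s]]
    by (simp add: image_struct_def)
  ultimately show ?thesis
    using sM inj_on_imp_bij_betw[OF inj] unfolding iso_def univ_image_struct by blast
qed

text \<open>On tuples over the common universe both structures copy \<open>P\<close>; elsewhere
  \<open>is_structure\<close> fixes default values. So a substructure of \<open>P\<close> is
  determined by its universe.\<close>

lemma substructure_eqI:
  assumes M: "substructure \<tau> M P" and N: "substructure \<tau> N P" and U: "univ M = univ N"
  shows "M = N"
proof -
  have s: "is_structure \<tau> M" "is_structure \<tau> N" using M N unfolding substructure_def by auto
  have "fun_int M s = fun_int N s" for s
  proof (cases "s \<in> funs \<tau>")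
    case True
    show ?thesis
    proof (rule extensionalityI[of _ "arity \<tau> s \<rightarrow>\<^sub>E univ M"])
      show "fun_int M s \<in> extensional (arity \<tau> s \<rightarrow>\<^sub>E univ M)"
        "fun_int N s \<in> extensional (arity \<tau> s \<rightarrow>\<^sub>E univ M)"
        using s True U unfolding is_structure_def PiE_def by auto
      show "fun_int M s t = fun_int N s t" if "t \<in> arity \<tau> s \<rightarrow>\<^sub>E univ M" for t
        using substructure_fun_int[OF M True, of t] substructure_fun_int[OF N True, of t] U that by simp
    qed
  qed (use s in \<open>simp add: is_structure_def\<close>)
  moreover have "rel_int M s = rel_int N s" for s
  proof (cases "s \<in> rels \<tau>")
    case True
    then have "rel_int M s \<subseteq> arity \<tau> s \<rightarrow>\<^sub>E univ M" "rel_int N s \<subseteq> arity \<tau> s \<rightarrow>\<^sub>E univ M"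
      using s U unfolding is_structure_def by auto
    then show ?thesis
      using substructure_rel_int[OF M True] substructure_rel_int[OF N True] U by auto
  qed (use s in \<open>simp add: is_structure_def\<close>)
  ultimately show ?thesis using U by (simp add: fun_eq_iff)
qed

lemma substructure_of_common:
  fixes M N P :: "('s, 'u) struct"
  assumes M: "substructure \<tau> M P" and N: "substructure \<tau> N P" and U: "univ M \<subseteq> univ N"
  shows "substructure \<tau> M N"
proof -
  have t: "t \<in> Q \<rightarrow>\<^sub>E univ N" if "t \<in> Q \<rightarrow>\<^sub>E univ M" for t and Q :: "'u set"
    using that U by auto
  show ?thesis
    unfolding substructure_def
  proof (intro conjI ballI)
    show "fun_int M s u = fun_int N s u"
      if "s \<in> funs \<tau>" "u \<in> arity \<tau> s \<rightarrow>\<^sub>E univ M" for s u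
      using substructure_fun_int[OF M that] substructure_fun_int[OF N that(1) t[OF that(2)]] by simp
    show "u \<in> rel_int M s \<longleftrightarrow> u \<in> rel_int N s"
      if "s \<in> rels \<tau>" "u \<in> arity \<tau> s \<rightarrow>\<^sub>E univ M" for s u
      using substructure_rel_int[OF M that] substructure_rel_int[OF N that(1) t[OF that(2)]] by simp
  qed (use assms in \<open>auto simp: substructure_def\<close>)
qed

section \<open>Cardinals below an inaccessible\<close>

text \<open>Constructions such as \<open>cardSuc\<close> and \<open>Pow\<close> leave the type
  \<open>'u\<close>, while \<open>cardinal\<close> speaks of relations on \<open>'u\<close> only.
  This brings small sizes back to \<open>'u\<close>.\<close>

lemma ex_card_ordIso:
  fixes A :: "'b set"
  assumes "|A| <o |UNIV :: 'u set|"
  shows "\<exists>B :: 'u set. |B| =o |A|"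
proof -
  obtain f :: "'b \<Rightarrow> 'u" where "inj_on f A"
    using ordLess_imp_ordLeq[OF assms] unfolding card_of_ordLeq[symmetric] by blast
  then have "|f ` A| =o |A|"
    using card_of_ordIsoI inj_on_imp_bij_betw ordIso_symmetric by metis
  then show ?thesis by blast
qed

lemma inaccessible_Pow:
  fixes A :: "'b set"
  assumes "inaccessible |UNIV :: 'u set|" and A: "|A| <o |UNIV :: 'u set|"
  shows "|Pow A| <o |UNIV :: 'u set|"
proof -
  obtain B :: "'u set" where B: "|B| =o |A|" using ex_card_ordIso[OF A] by blast
  then have "|Pow B| <o |UNIV :: 'u set|"
    using assms ordIso_ordLess_trans[OF B A] unfolding inaccessible_def by (simp add: Field_card_of)
  moreover obtain f where f: "bij_betw f A B"
    using B card_of_ordIso ordIso_symmetric by metis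
  then have "|Pow A| =o |Pow B|"
    using card_of_ordIsoI[OF bij_betw_Pow] by blast
  ultimately show ?thesis by (rule ordIso_ordLess_trans[rotated])
qed

lemma inaccessible_Sigma:
  assumes "inaccessible |UNIV :: 'u set|" and "|A| <o |UNIV :: 'u set|"
    and "\<And>a. a \<in> A \<Longrightarrow> |F a| <o |UNIV :: 'u set|"
  shows "|SIGMA a : A. F a| <o |UNIV :: 'u set|"
  using assms regularCard_stable[of "|UNIV :: 'u set|"]
  by (intro stable_elim) (auto simp: inaccessible_def cinfinite_def)

lemma cardinal_card_of: "cardinal |A| \<longleftrightarrow> small A" for A :: "'u set"
  by (simp add: cardinal_def small_def card_of_Card_order)

lemma small_Field: "cardinal \<kappa> \<Longrightarrow> small (Field \<kappa>)" for \<kappa> :: "'u rel"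
  unfolding cardinal_def small_def using card_of_Field_ordIso ordIso_ordLess_trans by blast

text \<open>\<open>cardSuc \<kappa>\<close> is a relation on sets, so a copy on \<open>'u\<close> is
  made. There is room for it because a successor is at most a power set, which inaccessibility keeps
  below the universe.\<close>

lemma ex_cardinal_cardSuc:
  fixes \<kappa> :: "'u rel"
  assumes inac: "inaccessible |UNIV :: 'u set|" and \<kappa>: "cardinal \<kappa>"
  shows "\<exists>\<sigma> :: 'u rel. cardinal \<sigma> \<and> \<sigma> =o cardSuc \<kappa> \<and> (cinfinite \<kappa> \<longrightarrow> regular_cardinal \<sigma>)"
proof -
  have co: "Card_order \<kappa>" using \<kappa> unfolding cardinal_def by blast
  let ?S = "cardSuc \<kappa>"
  have S: "Card_order ?S" using co by (rule cardSuc_Card_order)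
  have "?S \<le>o |Pow (Field \<kappa>)|"
    using co Card_order_Pow cardSuc_least card_of_Card_order by blast
  also have "|Pow (Field \<kappa>)| <o |UNIV :: 'u set|"
    using inaccessible_Pow[OF inac] small_Field[OF \<kappa>] unfolding small_def by blast
  finally have lt: "?S <o |UNIV :: 'u set|" .
  moreover have FS: "|Field ?S| =o ?S" using S by (rule card_of_Field_ordIso)
  ultimately obtain B :: "'u set" where B: "|B| =o |Field ?S|"
    using ex_card_ordIso ordIso_ordLess_trans by blast
  then have BS: "|B| =o ?S" using FS by (rule ordIso_transitive)
  then have cB: "cardinal |B|"
    unfolding cardinal_def using lt ordIso_ordLess_trans card_of_Card_order by blast
  moreover have "regular_cardinal |B|" if "cinfinite \<kappa>"
  proof -
    have "Cinfinite ?S" using Cinfinite_cardSuc co that by blast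
    moreover have "regularCard ?S" using regularCard_cardSuc co that by blast
    ultimately show ?thesis
      using regularCard_ordIso[OF ordIso_symmetric[OF BS]] Cinfinite_cong[OF ordIso_symmetric[OF BS]] cB
      unfolding regular_cardinal_def by blast
  qed
  ultimately show ?thesis using BS by blast
qed

text \<open>A sequence is coded by its length and its graph, the values being moved into
  \<open>B\<close> by an injection. The bound is crude, but it depends on \<open>B\<close> only and
  is small when \<open>B\<close> and \<open>Field \<mu>\<close> are.\<close>

lemma power_less_mono_bound:
  assumes "|A| \<le>o |B|"
  shows "power_less |A| \<mu> \<le>o |Field \<mu> \<times> Pow (Field \<mu> \<times> B)|"
proof -
  obtain f where f: "inj_on f A" "f ` A \<subseteq> B"
    using assms unfolding card_of_ordLeq[symmetric] by blast
  have "|underS \<mu> \<alpha> \<rightarrow>\<^sub>E A| \<le>o |Pow (Field \<mu> \<times> B)|" for \<alpha>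
    unfolding card_of_ordLeq[symmetric]
  proof (intro exI conjI)
    let ?g = "\<lambda>t. {(x, f (t x)) |x. x \<in> underS \<mu> \<alpha>}"
    show "inj_on ?g (underS \<mu> \<alpha> \<rightarrow>\<^sub>E A)"
    proof (rule inj_onI)
      fix t u assume t: "t \<in> underS \<mu> \<alpha> \<rightarrow>\<^sub>E A" and u: "u \<in> underS \<mu> \<alpha> \<rightarrow>\<^sub>E A" and eq: "?g t = ?g u"
      show "t = u"
      proof (rule PiE_ext[OF t u])
        fix x assume x: "x \<in> underS \<mu> \<alpha>"
        then have "(x, f (t x)) \<in> ?g u" using eq by blast
        then have "f (t x) = f (u x)" by blast
        then show "t x = u x" using f(1) PiE_mem[OF t x] PiE_mem[OF u x] by (simp add: inj_on_eq_iff)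
      qed
    qed
    show "?g ` (underS \<mu> \<alpha> \<rightarrow>\<^sub>E A) \<subseteq> Pow (Field \<mu> \<times> B)"
      using f(2) by (auto simp: underS_def Field_def PiE_iff)
  qed
  then show ?thesis
    unfolding power_less_def Field_card_of by (intro card_of_Sigma_mono1) simp
qed

section \<open>Sets of size below a regular cardinal\<close>

lemma regular_UN_less:
  "regular_cardinal \<theta> \<Longrightarrow> |X| <o \<theta> \<Longrightarrow> (\<And>x. x \<in> X \<Longrightarrow> |F x| <o \<theta>) \<Longrightarrow> |\<Union>x\<in>X. F x| <o \<theta>"
  by (intro card_of_UNION_ordLess_infinite_Field_regularCard)
    (auto simp: regular_cardinal_def cardinal_def)

lemma finite_less_regular: "regular_cardinal \<theta> \<Longrightarrow> finite X \<Longrightarrow> |X| <o \<theta>"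
  using finite_ordLess_infinite[of "|X|" \<theta>] card_of_Well_order[of X]
  by (simp add: regular_cardinal_def cinfinite_def cardinal_def Field_card_of card_order_on_def)

text \<open>Cofinal subsets of a regular cardinal have full cardinality, so \<open>X\<close> is not
  cofinal. Totality of the order turns the element witnessing this into an upper bound.\<close>

lemma regular_bounded:
  fixes \<theta> :: "'u rel"
  assumes \<theta>: "regular_cardinal \<theta>" and X: "X \<subseteq> Field \<theta>" "|X| <o \<theta>"
  shows "\<exists>b \<in> Field \<theta>. \<forall>x \<in> X. (x, b) \<in> \<theta>"
proof -
  have wo: "wo_rel \<theta>"
    using \<theta> unfolding wo_rel_def regular_cardinal_def cardinal_def card_order_on_def by blast
  have "\<not> |X| =o \<theta>" using X(2) not_ordLess_ordIso by blast
  then obtain b where b: "b \<in> Field \<theta>" "\<forall>x\<in>X. b = x \<or> (b, x) \<notin> \<theta>"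
    using \<theta> X(1) unfolding regular_cardinal_def regularCard_def cofinal_def by blast
  have "(x, b) \<in> \<theta>" if "x \<in> X" for x
    using b that X(1) wo_rel.TOTALS[OF wo] by (metis subsetD)
  with b show ?thesis by blast
qed

lemma card_underS_less:
  "cardinal \<theta> \<Longrightarrow> \<alpha> \<in> Field \<theta> \<Longrightarrow> |underS \<theta> \<alpha>| <o \<theta>"
  by (simp add: cardinal_def card_of_underS)

section \<open>Presentability ranks in concrete categories\<close>

lemma directed_poset_mono: "directed_poset \<theta> I r \<Longrightarrow> \<kappa> \<le>o \<theta> \<Longrightarrow> directed_poset \<kappa> I r"
  unfolding directed_poset_def using ordLess_ordLeq_trans by blast

lemma presentable_mono: "presentable C \<kappa> M \<Longrightarrow> \<kappa> \<le>o \<theta> \<Longrightarrow> presentable C \<theta> M"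
  unfolding presentable_def using directed_poset_mono by blast

text \<open>Cardinals are well-ordered by size, so once some regular cardinal presents
  \<open>M\<close> there is a least one, and the \<open>SOME\<close> in the definition of the rank
  meets its specification.\<close>

lemma presentability_rank:
  assumes "\<exists>\<theta>. regular_cardinal \<theta> \<and> presentable C \<theta> M"
  shows "regular_cardinal (presentability_rank C M)"
    and "presentable C (presentability_rank C M) M"
    and "\<And>\<kappa>. regular_cardinal \<kappa> \<Longrightarrow> presentable C \<kappa> M \<Longrightarrow> presentability_rank C M \<le>o \<kappa>"
proof -
  let ?R = "{\<theta>. regular_cardinal \<theta> \<and> presentable C \<theta> M}"
  have "\<exists>\<theta>\<in>?R. \<forall>\<kappa>\<in>?R. \<theta> \<le>o \<kappa>"
    using assms by (intro exists_minim_Card_order) (auto simp: regular_cardinal_def cardinal_def)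
  then have "\<exists>\<theta>. regular_cardinal \<theta> \<and> presentable C \<theta> M \<and>
     (\<forall>\<kappa>. regular_cardinal \<kappa> \<and> presentable C \<kappa> M \<longrightarrow> \<theta> \<le>o \<kappa>)" by blast
  note rank = someI_ex[OF this, folded presentability_rank_def]
  show "regular_cardinal (presentability_rank C M)"
    "presentable C (presentability_rank C M) M"
    "\<And>\<kappa>. regular_cardinal \<kappa> \<Longrightarrow> presentable C \<kappa> M \<Longrightarrow> presentability_rank C M \<le>o \<kappa>"
    using rank by blast+
qed

text \<open>The predecessor picked by \<open>SOME\<close> need not be \<open>\<chi>\<close> itself;
  it agrees with \<open>\<chi>\<close> up to \<open>=o\<close> because \<open>cardSuc\<close> is
  injective on cardinals up to \<open>=o\<close>.\<close>

lemma internal_size_successor: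
  fixes C :: "('o, 'u) concrete_cat" and \<chi> :: "'u rel"
  assumes \<chi>: "cardinal \<chi>" and rank: "presentability_rank C M =o cardSuc \<chi>"
  shows "internal_size C M =o \<chi>"
proof -
  have ex: "\<exists>\<chi> :: 'u rel. cardinal \<chi> \<and> presentability_rank C M =o cardSuc \<chi>" using assms by blast
  define \<xi> :: "'u rel" where "\<xi> = (SOME \<chi>. cardinal \<chi> \<and> presentability_rank C M =o cardSuc \<chi>)"
  have \<xi>: "cardinal \<xi>" "presentability_rank C M =o cardSuc \<xi>"
    using someI_ex[OF ex] unfolding \<xi>_def by blast+
  have "cardSuc \<xi> =o cardSuc \<chi>"
    using ordIso_symmetric[OF \<xi>(2)] rank by (rule ordIso_transitive)
  then have "\<xi> =o \<chi>" using \<xi>(1) \<chi> cardSuc_invar_ordIso unfolding cardinal_def by blast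
  then show ?thesis using ex unfolding internal_size_def successor_cardinal_def \<xi>_def by simp
qed

text \<open>If no leg hits \<open>x\<close>, then the identity and its modification at
  \<open>x\<close> are two factorizations of the same cocone, against uniqueness. The modification
  needs a second element of the type.\<close>

lemma colimit_set_cat_surj:
  fixes X :: "'x set" and D :: "'i \<Rightarrow> 'x set"
  assumes colim: "colimit set_cat I r D d X c" and x: "x \<in> X" and nontriv: "\<exists>y :: 'x. y \<noteq> x"
  shows "\<exists>i\<in>I. x \<in> c i ` D i"
proof (rule ccontr)
  assume none: "\<not> ?thesis"
  obtain y where y: "y \<noteq> x" using nontriv by blast
  have coc: "cocone set_cat I r D d X c" using colim unfolding colimit_def by blast
  have c: "c i \<in> D i \<rightarrow>\<^sub>E X" if "i \<in> I" for i
    using coc that unfolding cocone_def set_cat_def by simp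
  let ?h = "\<lambda>z \<in> X. z" and ?k = "(\<lambda>z \<in> X. z)(x := y)"
  \<comment> \<open>The vertex is enlarged to the whole type, since \<open>y\<close> need not lie in
    \<open>X\<close>, which may be a singleton.\<close>
  have "cocone set_cat I r D d (UNIV :: 'x set) c"
    using coc unfolding cocone_def set_cat_def by (auto simp: PiE_def)
  then have ex1: "\<exists>!h. h \<in> X \<rightarrow>\<^sub>E UNIV \<and> (\<forall>i \<in> I. c i = compose (D i) h (c i))"
    using colim unfolding colimit_def set_cat_def by simp
  have "c i = compose (D i) ?h (c i) \<and> c i = compose (D i) ?k (c i)" if "i \<in> I" for i
    using c[OF that] none that by (fastforce simp: compose_def fun_eq_iff PiE_iff extensional_def)
  moreover have "?h \<in> X \<rightarrow>\<^sub>E UNIV" "?k \<in> X \<rightarrow>\<^sub>E UNIV"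
    using x by (auto simp: PiE_def extensional_def)
  ultimately have "?h = ?k" using ex1 by blast
  then have "?h x = ?k x" by simp
  with x y show False by simp
qed

section \<open>Abstract elementary classes\<close>

lemma univ_union_struct [simp]: "univ (union_struct \<tau> I M) = (\<Union>i \<in> I. univ (M i))"
  by (simp add: union_struct_def)

lemma cat_of_simps [simp]:
  "obj (cat_of K) = models K" "carr (cat_of K) = univ" "hom (cat_of K) = embeddings K"
  by (simp_all add: cat_of_def)

locale muAEC =
  fixes \<mu> :: "'u rel" and K :: "('s, 'u) aclass"
  assumes regular_mu: "regular_cardinal \<mu>" and mu_AEC: "mu_AEC \<mu> K"
begin

abbreviation "\<tau> \<equiv> voc K"

section \<open>First consequences of the axioms\<close>

lemma abstract: "abstract_class \<mu> K"
  using mu_AEC unfolding mu_AEC_def by blast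

lemma models_structure: "M \<in> models K \<Longrightarrow> is_structure \<tau> M"
  using abstract unfolding abstract_class_def by blast

lemma iso_models: "iso \<tau> f M N \<Longrightarrow> M \<in> models K \<Longrightarrow> N \<in> models K"
  using abstract unfolding abstract_class_def by blast

lemma partial_order_le: "partial_order_on (models K) (le K)"
  using abstract unfolding abstract_class_def by blast

lemma le_models: "(M, N) \<in> le K \<Longrightarrow> M \<in> models K" "(M, N) \<in> le K \<Longrightarrow> N \<in> models K"
  using partial_order_onD(4)[OF partial_order_le] by blast+

lemma le_refl: "M \<in> models K \<Longrightarrow> (M, M) \<in> le K"
  using partial_order_onD(1)[OF partial_order_le] by (rule refl_onD)

lemma le_trans: "(M, N) \<in> le K \<Longrightarrow> (N, P) \<in> le K \<Longrightarrow> (M, P) \<in> le K"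
  using partial_order_onD(2)[OF partial_order_le] by (rule transD)

lemma le_iso: "(M, N) \<in> le K \<Longrightarrow> iso \<tau> f N N' \<Longrightarrow> iso \<tau> f M M' \<Longrightarrow> (M', N') \<in> le K"
  using abstract unfolding abstract_class_def by blast

lemma le_substructure: "(M, N) \<in> le K \<Longrightarrow> substructure \<tau> M N"
  using abstract unfolding abstract_class_def by blast

lemma le_univ: "(M, N) \<in> le K \<Longrightarrow> univ M \<subseteq> univ N"
  using le_substructure unfolding substructure_def by blast

text \<open>Two submodels of \<open>P\<close> carry the structure of \<open>P\<close>, so inclusion
  of universes already yields the substructure relation required by the coherence axiom. Submodels
  of one model are thus compared by universes alone.\<close>

lemma le_coherence:
  assumes "(M, P) \<in> le K" "(N, P) \<in> le K" "univ M \<subseteq> univ N"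
  shows "(M, N) \<in> le K"
proof -
  have "substructure \<tau> M N"
    using assms by (intro substructure_of_common[of _ M P N] le_substructure)
  then show ?thesis
    using mu_AEC assms le_models unfolding mu_AEC_def coherence_def by blast
qed

lemma le_eqI: "(M, P) \<in> le K \<Longrightarrow> (N, P) \<in> le K \<Longrightarrow> univ M = univ N \<Longrightarrow> M = N"
  by (rule substructure_eqI[of \<tau> M P N]) (auto dest: le_substructure)

lemma iso_univ: "iso \<tau> f M N \<Longrightarrow> univ N = f ` univ M" "iso \<tau> f M N \<Longrightarrow> inj_on f (univ M)"
  unfolding iso_def bij_betw_def by simp_all

lemma le_image_struct:
  assumes "(M, N) \<in> le K" and f: "iso \<tau> f N N'"
  shows "iso \<tau> f M (image_struct \<tau> f M)" and "(image_struct \<tau> f M, N') \<in> le K"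
proof -
  show i: "iso \<tau> f M (image_struct \<tau> f M)"
    using assms(1) by (intro iso_image_struct models_structure le_models(1)
        inj_on_subset[OF iso_univ(2)[OF f]] le_univ)
  then show "(image_struct \<tau> f M, N') \<in> le K" using le_iso assms by blast
qed

section \<open>K-embeddings, their composition and factorization\<close>

lemma embeddingE:
  assumes "f \<in> embeddings K M N"
  obtains M' where "iso \<tau> f M M'" "(M', N) \<in> le K" "univ M' = f ` univ M"
  using assms iso_univ(1) unfolding embeddings_def by blast

lemma embeddingI:
  "iso \<tau> f M M' \<Longrightarrow> (M', N) \<in> le K \<Longrightarrow> f \<in> extensional (univ M) \<Longrightarrow> f \<in> embeddings K M N"
  unfolding embeddings_def by blast

lemma embedding_extensional: "f \<in> embeddings K M N \<Longrightarrow> f \<in> extensional (univ M)"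
  unfolding embeddings_def by simp

lemma embedding_inj: "f \<in> embeddings K M N \<Longrightarrow> inj_on f (univ M)"
  by (elim embeddingE) (rule iso_univ(2))

lemma embedding_image: "f \<in> embeddings K M N \<Longrightarrow> f ` univ M \<subseteq> univ N"
  by (elim embeddingE) (use le_univ in blast)

lemma embedding_PiE: "f \<in> embeddings K M N \<Longrightarrow> f \<in> univ M \<rightarrow>\<^sub>E univ N"
  using embedding_image[of f M N] embedding_extensional[of f M N] by (auto simp: PiE_iff)

lemma embedding_compose:
  assumes f: "f \<in> embeddings K M N" and g: "g \<in> embeddings K N P"
  shows "compose (univ M) g f \<in> embeddings K M P"
proof -
  obtain M' where M': "iso \<tau> f M M'" "(M', N) \<in> le K" using f by (rule embeddingE)
  obtain N' where N': "iso \<tau> g N N'" "(N', P) \<in> le K" using g by (rule embeddingE)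
  note im = le_image_struct[OF M'(2) N'(1)]
  have "iso \<tau> (compose (univ M) g f) M (image_struct \<tau> g M')"
    by (rule iso_cong[OF iso_comp[OF M'(1) im(1)]]) (simp add: compose_def)
  then show ?thesis by (rule embeddingI[OF _ le_trans[OF im(2) N'(2)]]) simp
qed

lemma embedding_inclusion:
  assumes "(M, N) \<in> le K"
  shows "(\<lambda>x \<in> univ M. x) \<in> embeddings K M N"
proof -
  have "iso \<tau> (\<lambda>x \<in> univ M. x) M M"
    using iso_id[OF models_structure[OF le_models(1)[OF assms]]] by (rule iso_cong) simp
  then show ?thesis by (rule embeddingI[OF _ assms]) simp
qed

lemma embedding_le_codomain: "f \<in> embeddings K M N \<Longrightarrow> (N, P) \<in> le K \<Longrightarrow> f \<in> embeddings K M P"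
  using le_trans unfolding embeddings_def by blast

text \<open>The factor is the inverse of \<open>c\<close> after \<open>f\<close>. The images f[M]
  and c[D] are submodels of \<open>X\<close>, so by coherence the first is a submodel of the second,
  and this relation is pulled back along \<open>c\<close> to \<open>D\<close>.\<close>

lemma embedding_factor:
  assumes f: "f \<in> embeddings K M X" and c: "c \<in> embeddings K D X"
    and sub: "f ` univ M \<subseteq> c ` univ D"
  shows "\<exists>g \<in> embeddings K M D. f = compose (univ M) c g"
proof -
  obtain M' where M': "iso \<tau> f M M'" "(M', X) \<in> le K" "univ M' = f ` univ M"
    using f by (rule embeddingE)
  obtain D' where D': "iso \<tau> c D D'" "(D', X) \<in> le K" "univ D' = c ` univ D"
    using c by (rule embeddingE)
  let ?b = "inv_into (univ D) c"
  have "(M', D') \<in> le K" using sub M'(3) D'(3) by (intro le_coherence[OF M'(2) D'(2)]) simp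
  note im = le_image_struct[OF this iso_inv_into[OF D'(1)]]
  have "iso \<tau> (compose (univ M) ?b f) M (image_struct \<tau> ?b M')"
    by (rule iso_cong[OF iso_comp[OF M'(1) im(1)]]) (simp add: compose_def)
  then have "compose (univ M) ?b f \<in> embeddings K M D" by (rule embeddingI[OF _ im(2)]) simp
  moreover have "f = compose (univ M) c (compose (univ M) ?b f)"
  proof (rule extensionalityI[OF embedding_extensional[OF f]])
    fix x assume "x \<in> univ M"
    then show "f x = compose (univ M) c (compose (univ M) ?b f) x"
      using sub by (simp add: compose_def f_inv_into_f image_subset_iff)
  qed simp
  ultimately show ?thesis by blast
qed

section \<open>Directed unions and colimits\<close>

lemma directed_union:
  assumes "directed_system \<mu> K I r M"
  shows "union_struct \<tau> I M \<in> models K"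
    and "\<And>i. i \<in> I \<Longrightarrow> (M i, union_struct \<tau> I M) \<in> le K"
    and "\<And>N. N \<in> models K \<Longrightarrow> (\<And>i. i \<in> I \<Longrightarrow> (M i, N) \<in> le K) \<Longrightarrow> (union_struct \<tau> I M, N) \<in> le K"
  using assms mu_AEC unfolding mu_AEC_def chain_axioms_def by blast+

lemma directed_poset_mem:
  assumes "directed_poset \<theta> I r" "(i, j) \<in> r"
  shows "i \<in> I" "j \<in> I"
  using assms partial_order_onD(4) unfolding directed_poset_def by blast+

lemma directed_poset_pair:
  assumes "directed_poset \<theta> I r" "regular_cardinal \<theta>" "i \<in> I" "j \<in> I"
  shows "\<exists>k \<in> I. (i, k) \<in> r \<and> (j, k) \<in> r"
proof -
  have "|{i, j}| <o \<theta>" using assms(2) by (simp add: finite_less_regular)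
  then obtain k where "k \<in> I" "\<forall>x\<in>{i, j}. (x, k) \<in> r"
    using assms unfolding directed_poset_def by (metis empty_subsetI insert_subset)
  then show ?thesis by blast
qed

text \<open>
  The union \<open>W\<close> of the images of a colimit cocone \<open>c\<close> is itself a model \<open>W \<le> X\<close>; the map
  \<open>X \<rightarrow> W\<close> induced by \<open>c\<close> must be the identity on \<open>X\<close>, so \<open>W = X\<close>. This avoids constructing
  colimits of diagrams that are not systems of substructures.
\<close>

lemma colimit_univ:
  assumes dir: "directed_poset \<mu> I r" and diag: "diagram (cat_of K) I r D d"
    and colim: "colimit (cat_of K) I r D d X c"
  shows "univ X = (\<Union>i\<in>I. c i ` univ (D i))"
proof -
  have coc: "X \<in> models K" "\<And>i. i \<in> I \<Longrightarrow> c i \<in> embeddings K (D i) X"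
    "\<And>i j. (i, j) \<in> r \<Longrightarrow> c i = compose (univ (D i)) (c j) (d i j)"
    using colim unfolding colimit_def cocone_def by simp_all
  have "\<forall>i\<in>I. \<exists>C. iso \<tau> (c i) (D i) C \<and> (C, X) \<in> le K \<and> univ C = c i ` univ (D i)"
    using coc(2) by (meson embeddingE)
  then obtain C where C: "\<And>i. i \<in> I \<Longrightarrow> iso \<tau> (c i) (D i) (C i)"
    "\<And>i. i \<in> I \<Longrightarrow> (C i, X) \<in> le K" "\<And>i. i \<in> I \<Longrightarrow> univ (C i) = c i ` univ (D i)"
    by metis
  have "(C i, C j) \<in> le K" if ij: "(i, j) \<in> r" for i j
  proof -
    note mem = directed_poset_mem[OF dir ij]
    have "d i j \<in> embeddings K (D i) (D j)" using diag ij unfolding diagram_def by simp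
    then have "c i ` univ (D i) \<subseteq> c j ` univ (D j)"
      using embedding_image unfolding coc(3)[OF ij] by (fastforce simp: compose_def)
    then show ?thesis using le_coherence[of "C i" X "C j"] C mem by simp
  qed
  then have sys: "directed_system \<mu> K I r C"
    using dir C(2) le_models(1) unfolding directed_system_def by blast
  define W where "W = union_struct \<tau> I C"
  note W = directed_union[OF sys, folded W_def]
  have WX: "(W, X) \<in> le K" using W(3) coc(1) C(2) by blast
  have uW: "univ W = (\<Union>i\<in>I. c i ` univ (D i))" using C(3) unfolding W_def by simp
  have cocW: "cocone (cat_of K) I r D d W c"
    unfolding cocone_def
    using W(1) coc(3) embeddingI[OF C(1) W(2) embedding_extensional[OF coc(2)]] by simp
  then obtain h where h: "h \<in> embeddings K X W" "\<And>i. i \<in> I \<Longrightarrow> c i = compose (univ (D i)) h (c i)"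
    using colim unfolding colimit_def by (metis cat_of_simps(2,3))
  let ?id = "\<lambda>x \<in> univ X. x"
  have "c i = compose (univ (D i)) ?id (c i)" if "i \<in> I" for i
    using Id_compose embedding_PiE[OF coc(2)[OF that]] by (metis PiE_iff PiE_def IntE)
  moreover have "cocone (cat_of K) I r D d X c" using colim unfolding colimit_def by blast
  \<comment> \<open>Read as a map into \<open>X\<close>, \<open>h\<close> is a factorization of
    \<open>c\<close> through itself, and so is the identity; uniqueness identifies them.\<close>
  ultimately have "h = ?id"
    using colim h embedding_le_codomain[OF h(1) WX] embedding_inclusion[OF le_refl[OF coc(1)]]
    unfolding colimit_def by (metis cat_of_simps(2,3))
  then have "univ X \<subseteq> univ W" using embedding_image[OF h(1)] by auto
  then show ?thesis using le_univ[OF WX] uW by blast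
qed

text \<open>The chain axioms treat only upper bounds by inclusion. A cocone of arbitrary embeddings
  is reduced to that case by gluing its legs to \<open>h\<close> and passing to the images of the
  stages under \<open>h\<close>. As a function an inclusion depends only on its source, which is why
  the transition map from \<open>i\<close> to \<open>j\<close> does not mention
  \<open>j\<close>.\<close>

lemma colimit_directed_union:
  assumes sys: "directed_system \<mu> K I r D"
  defines "incl \<equiv> \<lambda>i. \<lambda>x \<in> univ (D i). x"
  shows "diagram (cat_of K) I r D (\<lambda>i j. incl i)"
    and "colimit (cat_of K) I r D (\<lambda>i j. incl i) (union_struct \<tau> I D) incl"
proof -
  have dir: "directed_poset \<mu> I r" and le: "\<And>i j. (i, j) \<in> r \<Longrightarrow> (D i, D j) \<in> le K"
    and models: "\<And>i. i \<in> I \<Longrightarrow> D i \<in> models K"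
    using sys unfolding directed_system_def by blast+
  have comp: "compose (univ (D i)) (incl j) (incl i) = incl i" if "(i, j) \<in> r" for i j
    using le_univ[OF le[OF that]] by (auto simp: incl_def compose_def fun_eq_iff restrict_def)
  show "diagram (cat_of K) I r D (\<lambda>i j. incl i)"
    unfolding diagram_def using models le comp embedding_inclusion by (simp add: incl_def)
  define U where "U = union_struct \<tau> I D"
  note U = directed_union[OF sys, folded U_def]
  have uU: "univ U = (\<Union>i\<in>I. univ (D i))" unfolding U_def by simp
  have "cocone (cat_of K) I r D (\<lambda>i j. incl i) U incl"
    unfolding cocone_def using U comp embedding_inclusion by (simp add: incl_def)
  moreover have "\<exists>!h. h \<in> embeddings K U Y \<and> (\<forall>i \<in> I. e i = compose (univ (D i)) h (incl i))"
    if "cocone (cat_of K) I r D (\<lambda>i j. incl i) Y e" for Y e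
  proof -
    have Y: "Y \<in> models K" and e: "\<And>i. i \<in> I \<Longrightarrow> e i \<in> embeddings K (D i) Y"
      and ee: "\<And>i j. (i, j) \<in> r \<Longrightarrow> e i = compose (univ (D i)) (e j) (incl i)"
      using that unfolding cocone_def by simp_all
    have agree: "e i x = e j x" if "i \<in> I" "j \<in> I" "x \<in> univ (D i)" "x \<in> univ (D j)" for i j x
    proof -
      obtain k where "(i, k) \<in> r" "(j, k) \<in> r"
        using directed_poset_pair[OF dir regular_mu] \<open>i \<in> I\<close> \<open>j \<in> I\<close> by blast
      with that ee[of i k] ee[of j k] show ?thesis by (simp add: compose_def incl_def)
    qed
    \<comment> \<open>An arbitrary stage containing \<open>x\<close> is used; by
      \<open>agree\<close> the value is the same for all of them.\<close>
    define h where "h = (\<lambda>x \<in> univ U. e (SOME i. i \<in> I \<and> x \<in> univ (D i)) x)"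
    have h: "h x = e i x" if "i \<in> I" "x \<in> univ (D i)" for i x
    proof -
      define j where "j = (SOME i. i \<in> I \<and> x \<in> univ (D i))"
      have "j \<in> I \<and> x \<in> univ (D j)"
        unfolding j_def by (rule someI[of _ i]) (use that in blast)
      moreover have "h x = e j x" using that uU unfolding h_def j_def by auto
      ultimately show ?thesis using agree[of j i x] that by simp
    qed
    have "inj_on h (univ U)"
    proof (rule inj_onI)
      fix x y assume "x \<in> univ U" "y \<in> univ U" and eq: "h x = h y"
      then obtain i j where ij: "i \<in> I" "j \<in> I" "x \<in> univ (D i)" "y \<in> univ (D j)" using uU by blast
      then obtain k where k: "k \<in> I" "(i, k) \<in> r" "(j, k) \<in> r"
        using directed_poset_pair[OF dir regular_mu] by blast
      then have "x \<in> univ (D k)" "y \<in> univ (D k)" using ij le le_univ by blast+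
      then show "x = y" using eq h[OF k(1)] embedding_inj[OF e[OF k(1)]] by (simp add: inj_on_eq_iff)
    qed
    then have iso_h: "iso \<tau> h U (image_struct \<tau> h U)" (is "iso \<tau> h U ?V")
      using iso_image_struct models_structure U(1) by blast
    have V: "?V \<in> models K" using iso_models[OF iso_h U(1)] .
    let ?E = "\<lambda>i. image_struct \<tau> h (D i)"
    have E: "(?E i, ?V) \<in> le K" if "i \<in> I" for i
      using le_image_struct[OF U(2)[OF that] iso_h] by blast
    \<comment> \<open>On stage \<open>i\<close> the map \<open>h\<close> is the leg
      \<open>e i\<close>. Its image \<open>M'\<close>, a submodel of \<open>Y\<close>, and
      \<open>?E i\<close> are submodels of \<open>?V\<close> with the same universe, hence
      equal.\<close>
    have EY: "(?E i, Y) \<in> le K" if i: "i \<in> I" for i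
    proof -
      obtain M' where M': "iso \<tau> (e i) (D i) M'" "(M', Y) \<in> le K" using e[OF i] by (rule embeddingE)
      have "iso \<tau> h (D i) M'" using M'(1) by (rule iso_cong) (simp add: h[OF i])
      then have "(M', ?V) \<in> le K" "univ M' = univ (?E i)"
        using le_iso[OF U(2)[OF i] iso_h] iso_univ(1) by auto
      then have "M' = ?E i" using le_eqI E[OF i] by blast
      then show ?thesis using M'(2) by simp
    qed
    have "(?E i, ?E j) \<in> le K" if ij: "(i, j) \<in> r" for i j
    proof -
      note mem = directed_poset_mem[OF dir ij]
      show ?thesis
        using le_coherence[OF E[OF mem(1)] E[OF mem(2)]] le_univ[OF le[OF ij]] by (simp add: image_mono)
    qed
    then have sysE: "directed_system \<mu> K I r ?E"
      using dir E le_models(1) unfolding directed_system_def by blast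
    \<comment> \<open>The image of \<open>h\<close> is the directed union of the images of the
      stages, all of them submodels of \<open>Y\<close>, so the last chain axiom puts it below
      \<open>Y\<close>.\<close>
    have "union_struct \<tau> I ?E = ?V"
      using le_eqI[OF directed_union(3)[OF sysE V E] le_refl[OF V]] uU by (simp add: image_UN)
    then have "(?V, Y) \<in> le K" using directed_union(3)[OF sysE Y EY] by simp
    then have emb: "h \<in> embeddings K U Y" by (rule embeddingI[OF iso_h]) (simp add: h_def)
    show ?thesis
    proof (rule ex1I[of _ h])
      show "h \<in> embeddings K U Y \<and> (\<forall>i \<in> I. e i = compose (univ (D i)) h (incl i))"
      proof (intro conjI ballI emb)
        fix i assume i: "i \<in> I"
        show "e i = compose (univ (D i)) h (incl i)"
          by (rule extensionalityI[OF embedding_extensional[OF e[OF i]]])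
            (simp_all add: compose_def incl_def h[OF i])
      qed
    next
      fix k assume k: "k \<in> embeddings K U Y \<and> (\<forall>i \<in> I. e i = compose (univ (D i)) k (incl i))"
      show "k = h"
      proof (rule extensionalityI)
        show "k \<in> extensional (univ U)" "h \<in> extensional (univ U)"
          using k emb embedding_extensional by blast+
        fix x assume "x \<in> univ U"
        then obtain i where i: "i \<in> I" "x \<in> univ (D i)" using uU by blast
        then have "e i x = compose (univ (D i)) k (incl i) x" using k by metis
        then show "k x = h x" using i by (simp add: h[OF i] compose_def incl_def)
      qed
    qed
  qed
  ultimately show "colimit (cat_of K) I r D (\<lambda>i j. incl i) (union_struct \<tau> I D) incl"
    unfolding colimit_def U_def by simp
qed

end

section \<open>Closures and generated models\<close>

definition generated :: "('s, 'u) aclass \<Rightarrow> 'u rel \<Rightarrow> ('s, 'u) struct \<Rightarrow> bool" where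
  "generated K \<theta> M \<longleftrightarrow> (\<exists>A \<subseteq> univ M. |A| <o \<theta> \<and> univ M \<subseteq> cl K M A)"

lemma subset_cl: "A \<subseteq> cl K N A"
  unfolding cl_def by blast

lemma cl_mono: "A \<subseteq> B \<Longrightarrow> cl K N A \<subseteq> cl K N B"
  unfolding cl_def by blast

locale muAEC_intersections = muAEC \<mu> K for \<mu> :: "'u rel" and K :: "('s, 'u) aclass" +
  assumes inaccessible: "inaccessible |UNIV :: 'u set|" and intersections: "admits_intersections K"
begin

lemma cl_least: "(M, N) \<in> le K \<Longrightarrow> A \<subseteq> univ M \<Longrightarrow> cl K N A \<subseteq> univ M"
  using le_models(1) unfolding cl_def by blast

text \<open>By \<open>le_eqI\<close> there is at most one such submodel, so the choice is
  harmless.\<close>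

definition hull :: "('s, 'u) struct \<Rightarrow> 'u set \<Rightarrow> ('s, 'u) struct" where
  "hull N A = (SOME M. (M, N) \<in> le K \<and> univ M = cl K N A)"

lemma hull:
  assumes "N \<in> models K" "A \<subseteq> univ N"
  shows "(hull N A, N) \<in> le K" "univ (hull N A) = cl K N A"
proof -
  have ex: "\<exists>M. (M, N) \<in> le K \<and> univ M = cl K N A"
    using intersections assms unfolding admits_intersections_def by blast
  show "(hull N A, N) \<in> le K" "univ (hull N A) = cl K N A"
    unfolding hull_def by (rule someI2_ex[OF ex], simp)+
qed

lemma hull_mono:
  assumes "N \<in> models K" "B \<subseteq> univ N" "A \<subseteq> B"
  shows "(hull N A, hull N B) \<in> le K"
proof -
  have A: "A \<subseteq> univ N" using assms by blast
  show ?thesis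
    using cl_mono[OF assms(3), of K N]
    by (intro le_coherence[OF hull(1)[OF assms(1) A] hull(1)[OF assms(1,2)]])
      (simp add: hull(2)[OF assms(1) A] hull(2)[OF assms(1,2)])
qed

text \<open>Submodels of \<open>M\<close> are submodels of \<open>N\<close>, which gives one
  inclusion. For the other, the hull in \<open>N\<close> lies inside \<open>M\<close>, and by
  coherence it is a submodel of \<open>M\<close>.\<close>

lemma cl_submodel:
  assumes MN: "(M, N) \<in> le K" and A: "A \<subseteq> univ M"
  shows "cl K M A = cl K N A"
proof
  note M = le_models(1)[OF MN] and N = le_models(2)[OF MN]
  have AN: "A \<subseteq> univ N" using A le_univ[OF MN] by blast
  show "cl K N A \<subseteq> cl K M A"
    using cl_least[OF le_trans[OF hull(1)[OF M A] MN]] hull(2)[OF M A] subset_cl[of A K M] by simp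
  have "(hull N A, M) \<in> le K"
    using cl_least[OF MN A] by (intro le_coherence[OF hull(1)[OF N AN] MN]) (simp add: hull(2)[OF N AN])
  then show "cl K M A \<subseteq> cl K N A"
    using cl_least[of "hull N A" M A] hull(2)[OF N AN] subset_cl[of A K N] by simp
qed

text \<open>The hull of f[A] in the image \<open>M'\<close> pulls back along \<open>f\<close> to a
  submodel of \<open>M\<close> containing \<open>A\<close>, hence to all of \<open>M\<close>. So
  f[M] lies in this hull, and \<open>cl_submodel\<close> replaces \<open>M'\<close> by
  \<open>X\<close>.\<close>

lemma embedding_image_cl:
  assumes f: "f \<in> embeddings K M X" and A: "A \<subseteq> univ M" and gen: "univ M \<subseteq> cl K M A"
  shows "f ` univ M \<subseteq> cl K X (f ` A)"
proof -
  obtain M' where M': "iso \<tau> f M M'" "(M', X) \<in> le K" "univ M' = f ` univ M"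
    using f by (rule embeddingE)
  note models = le_models[OF M'(2)]
  have fA: "f ` A \<subseteq> univ M'" using A M'(3) by blast
  note H = hull[OF models(1) fA]
  let ?b = "inv_into (univ M) f"
  let ?H = "image_struct \<tau> ?b (hull M' (f ` A))"
  have "(?H, M) \<in> le K" using le_image_struct(2)[OF H(1) iso_inv_into[OF M'(1)]] .
  moreover have "A \<subseteq> univ ?H"
  proof
    fix x assume x: "x \<in> A"
    then have "?b (f x) = x" using A iso_univ(2)[OF M'(1)] by (intro inv_into_f_f) auto
    moreover have "f x \<in> cl K M' (f ` A)" using x subset_cl[of "f ` A" K M'] by blast
    ultimately show "x \<in> univ ?H" using H(2) by (metis imageI univ_image_struct)
  qed
  ultimately have "univ M \<subseteq> univ ?H" using cl_least gen by blast
  then have "univ M \<subseteq> ?b ` cl K M' (f ` A)" using H(2) by simp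
  moreover have "f (?b y) = y" if "y \<in> cl K M' (f ` A)" for y
    using that le_univ[OF H(1)] H(2) M'(3) by (intro f_inv_into_f) auto
  ultimately have "f ` univ M \<subseteq> cl K M' (f ` A)" by force
  then show ?thesis using cl_submodel[OF M'(2) fA] by simp
qed

text \<open>Two facts identify hom(M, X) as the colimit of the sets hom(M, D i): every embedding of
  \<open>M\<close> in \<open>X\<close> factors through a leg (\<open>factor\<close>, from the few
  generators), and legs are injective, hence can be cancelled (\<open>cancel\<close>). A map induced
  by a cocone \<open>e\<close> then has to send \<open>f\<close> to \<open>e i g\<close> for any
  factorization of \<open>f\<close> through \<open>c i\<close> by \<open>g\<close>.\<close>

lemma generated_imp_presentable:
  assumes \<theta>: "regular_cardinal \<theta>" "\<mu> \<le>o \<theta>" and M: "generated K \<theta> M"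
  shows "presentable (cat_of K) \<theta> M"
  unfolding presentable_def
proof (intro allI impI, elim conjE)
  fix I :: "'u set" and r D d X c
  assume dir\<theta>: "directed_poset \<theta> I r" and diag: "diagram (cat_of K) I r D d"
    and colim: "colimit (cat_of K) I r D d X c"
  have dir: "directed_poset \<mu> I r" using directed_poset_mono dir\<theta> \<theta>(2) by blast
  have X: "X \<in> models K" and c: "\<And>i. i \<in> I \<Longrightarrow> c i \<in> embeddings K (D i) X"
    and cc: "\<And>i j. (i, j) \<in> r \<Longrightarrow> c i = compose (univ (D i)) (c j) (d i j)"
    using colim unfolding colimit_def cocone_def by simp_all
  have d: "\<And>i j. (i, j) \<in> r \<Longrightarrow> d i j \<in> embeddings K (D i) (D j)"
    using diag unfolding diagram_def by simp
  let ?H = "\<lambda>i. hom_map (cat_of K) M (D i)"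
  have H: "?H i g = (\<lambda>f \<in> embeddings K M (D i). compose (univ M) g f)" for i g
    unfolding hom_map_def by simp
  have comp: "compose (univ M) (c i) g = compose (univ M) (c j) (compose (univ M) (d i j) g)"
    if "(i, j) \<in> r" "g \<in> embeddings K M (D i)" for i j g
    using embedding_image[OF that(2)] by (subst cc[OF that(1)]) (auto simp: compose_def fun_eq_iff restrict_def)
  have factor: "\<exists>i\<in>I. \<exists>g \<in> embeddings K M (D i). f = compose (univ M) (c i) g"
    if f: "f \<in> embeddings K M X" for f
  proof -
    obtain A where A: "A \<subseteq> univ M" "|A| <o \<theta>" "univ M \<subseteq> cl K M A"
      using M unfolding generated_def by blast
    have "\<forall>a\<in>A. \<exists>i\<in>I. f a \<in> c i ` univ (D i)"
      using embedding_image[OF f] A(1) unfolding colimit_univ[OF dir diag colim] by blast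
    then obtain k where k: "\<And>a. a \<in> A \<Longrightarrow> k a \<in> I \<and> f a \<in> c (k a) ` univ (D (k a))" by metis
    have "|k ` A| <o \<theta>" using card_of_image A(2) by (rule ordLeq_ordLess_trans)
    moreover have "k ` A \<subseteq> I" using k by blast
    ultimately obtain u where u: "u \<in> I" "\<And>a. a \<in> A \<Longrightarrow> (k a, u) \<in> r"
      using dir\<theta> unfolding directed_poset_def by (metis imageI)
    obtain C where C: "iso \<tau> (c u) (D u) C" "(C, X) \<in> le K" "univ C = c u ` univ (D u)"
      using c[OF u(1)] by (rule embeddingE)
    have "f a \<in> univ C" if "a \<in> A" for a
      using k[OF that] embedding_image[OF d[OF u(2)[OF that]]] C(3)
      unfolding cc[OF u(2)[OF that]] by (auto simp: compose_def)
    then have "cl K X (f ` A) \<subseteq> univ C" using cl_least[OF C(2)] by blast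
    then have "f ` univ M \<subseteq> c u ` univ (D u)"
      using embedding_image_cl[OF f A(1,3)] C(3) by simp
    then show ?thesis using embedding_factor[OF f c[OF u(1)]] u(1) by blast
  qed
  have cancel: "g = g'" if "i \<in> I" "g \<in> embeddings K M (D i)" "g' \<in> embeddings K M (D i)"
    "compose (univ M) (c i) g = compose (univ M) (c i) g'" for i g g'
  proof (rule extensionalityI)
    show "g \<in> extensional (univ M)" "g' \<in> extensional (univ M)"
      using that embedding_extensional by blast+
    fix x assume x: "x \<in> univ M"
    then have "c i (g x) = c i (g' x)" using fun_cong[OF that(4), of x] by (simp add: compose_def)
    moreover have "g x \<in> univ (D i)" "g' x \<in> univ (D i)"
      using x that(2,3) embedding_image by blast+
    ultimately show "g x = g' x" using embedding_inj[OF c[OF that(1)]] by (simp add: inj_on_eq_iff)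
  qed
  have hom_c: "(\<lambda>f\<in>embeddings K M (D i). compose (univ M) (c i) f) \<in>
      embeddings K M (D i) \<rightarrow>\<^sub>E embeddings K M X" if "i \<in> I" for i
    using embedding_compose[OF _ c[OF that]] by auto
  have hom_cc: "(\<lambda>f\<in>embeddings K M (D i). compose (univ M) (c i) f) =
      compose (embeddings K M (D i)) (\<lambda>f\<in>embeddings K M (D j). compose (univ M) (c j) f)
        (\<lambda>f\<in>embeddings K M (D i). compose (univ M) (d i j) f)" if "(i, j) \<in> r" for i j
    using comp[OF that] embedding_compose[OF _ d[OF that]]
    by (auto simp: compose_def[of "embeddings K M (D i)"] fun_eq_iff restrict_def)
  show "colimit set_cat I r (\<lambda>i. hom (cat_of K) M (D i)) (\<lambda>i j. ?H i (d i j))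
     (hom (cat_of K) M X) (\<lambda>i. ?H i (c i))"
    unfolding colimit_def
  proof (intro conjI allI impI)
    show "cocone set_cat I r (\<lambda>i. hom (cat_of K) M (D i)) (\<lambda>i j. ?H i (d i j))
        (hom (cat_of K) M X) (\<lambda>i. ?H i (c i))"
      unfolding cocone_def set_cat_def H using hom_c hom_cc by simp
  next
    fix Y e
    assume "cocone set_cat I r (\<lambda>i. hom (cat_of K) M (D i)) (\<lambda>i j. ?H i (d i j)) Y e"
    then have e: "\<And>i. i \<in> I \<Longrightarrow> e i \<in> embeddings K M (D i) \<rightarrow>\<^sub>E Y"
      and ee: "\<And>i j. (i, j) \<in> r \<Longrightarrow> e i = compose (embeddings K M (D i)) (e j) (?H i (d i j))"
      unfolding cocone_def set_cat_def by simp_all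
    have e_d: "e i g = e j (compose (univ M) (d i j) g)"
      if "(i, j) \<in> r" "g \<in> embeddings K M (D i)" for i j g
      using fun_cong[OF ee[OF that(1)], of g] that(2) by (simp add: compose_eq H)
    have agree: "e i g = e j g'"
      if i: "i \<in> I" "g \<in> embeddings K M (D i)" and j: "j \<in> I" "g' \<in> embeddings K M (D j)"
        and eq: "compose (univ M) (c i) g = compose (univ M) (c j) g'" for i j g g'
    proof -
      obtain k where k: "k \<in> I" "(i, k) \<in> r" "(j, k) \<in> r"
        using directed_poset_pair[OF dir regular_mu i(1) j(1)] by blast
      \<comment> \<open>At the later stage \<open>k\<close> both maps have the same composite with
        \<open>c k\<close>, so they are equal there.\<close>
      have "compose (univ M) (d i k) g = compose (univ M) (d j k) g'"
        using cancel[OF k(1) embedding_compose[OF i(2) d[OF k(2)]] embedding_compose[OF j(2) d[OF k(3)]]]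
          eq comp[OF k(2) i(2)] comp[OF k(3) j(2)] by simp
      then show ?thesis using e_d[OF k(2) i(2)] e_d[OF k(3) j(2)] by simp
    qed
    \<comment> \<open>\<open>P f p\<close> says that \<open>p\<close> is a stage together with a
      factorization of \<open>f\<close> through it. Which pair \<open>SOME\<close> takes in
      \<open>h\<close> is immaterial by \<open>agree\<close>.\<close>
    define P where "P f p \<longleftrightarrow> fst p \<in> I \<and> snd p \<in> embeddings K M (D (fst p)) \<and>
      f = compose (univ M) (c (fst p)) (snd p)" for f p
    define h where "h = (\<lambda>f \<in> embeddings K M X. case SOME p. P f p of (i, g) \<Rightarrow> e i g)"
    have h: "h f = e i g" if "i \<in> I" "g \<in> embeddings K M (D i)" "f = compose (univ M) (c i) g" for f i g
    proof -
      define p where "p = (SOME p. P f p)"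
      have "P f p" unfolding p_def by (rule someI[of _ "(i, g)"]) (simp add: P_def that)
      then have "e (fst p) (snd p) = e i g" using that unfolding P_def by (intro agree) auto
      moreover have "f \<in> embeddings K M X" using that embedding_compose c by blast
      ultimately show ?thesis by (simp add: h_def p_def[symmetric] case_prod_beta)
    qed
    have hY: "h \<in> embeddings K M X \<rightarrow>\<^sub>E Y"
    proof (rule PiE_I)
      fix f assume "f \<in> embeddings K M X"
      then obtain i g where ig: "i \<in> I" "g \<in> embeddings K M (D i)" "f = compose (univ M) (c i) g"
        using factor by blast
      then show "h f \<in> Y" using h[OF ig] PiE_mem[OF e[OF ig(1)] ig(2)] by simp
    qed (simp add: h_def)
    have he: "e i = compose (embeddings K M (D i)) h (?H i (c i))" if "i \<in> I" for i
    proof (rule extensionalityI[of _ "embeddings K M (D i)"])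
      show "e i \<in> extensional (embeddings K M (D i))" using e[OF that] by (simp add: PiE_def)
      fix g assume "g \<in> embeddings K M (D i)"
      then show "e i g = compose (embeddings K M (D i)) h (?H i (c i)) g"
        using h[OF that, of g] by (simp add: compose_eq H)
    qed simp
    show "\<exists>!h. h \<in> hom set_cat (hom (cat_of K) M X) Y \<and>
        (\<forall>i\<in>I. e i = compose (carr set_cat (hom (cat_of K) M (D i))) h (?H i (c i)))"
    proof (rule ex1I[of _ h])
      show "h \<in> hom set_cat (hom (cat_of K) M X) Y \<and>
        (\<forall>i\<in>I. e i = compose (carr set_cat (hom (cat_of K) M (D i))) h (?H i (c i)))"
        using hY he by (simp add: set_cat_def)
    next
      fix h' assume "h' \<in> hom set_cat (hom (cat_of K) M X) Y \<and>
        (\<forall>i\<in>I. e i = compose (carr set_cat (hom (cat_of K) M (D i))) h' (?H i (c i)))"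
      then have h': "h' \<in> embeddings K M X \<rightarrow>\<^sub>E Y"
        "\<And>i. i \<in> I \<Longrightarrow> e i = compose (embeddings K M (D i)) h' (?H i (c i))"
        by (simp_all add: set_cat_def)
      show "h' = h"
      proof (rule PiE_ext[OF h'(1) hY])
        fix f assume "f \<in> embeddings K M X"
        then obtain i g where ig: "i \<in> I" "g \<in> embeddings K M (D i)" "f = compose (univ M) (c i) g"
          using factor by blast
        then show "h' f = h f"
          using h[OF ig] fun_cong[OF h'(2)[OF ig(1)], of g] by (simp add: compose_eq H)
      qed
    qed
  qed
qed

text \<open>
  Diagrams are indexed by subsets of \<open>'u\<close>, so the poset of subsets of \<open>U\<close> is coded by elements
  \<open>i\<close> with \<open>\<psi> i \<subseteq> U\<close>; inaccessibility makes room for the codes.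
\<close>

lemma directed_poset_subsets:
  assumes U: "small U" and \<theta>: "regular_cardinal \<theta>"
  obtains I :: "'u set" and r and \<psi> :: "'u \<Rightarrow> 'u set"
  where "directed_poset \<theta> I r" "\<And>i j. (i, j) \<in> r \<Longrightarrow> \<psi> i \<subseteq> \<psi> j"
    "\<psi> ` I = {A. A \<subseteq> U \<and> |A| <o \<theta>}"
proof -
  let ?S = "{A. A \<subseteq> U \<and> |A| <o \<theta>}"
  have "|Pow U| \<le>o |UNIV :: 'u set|"
    using inaccessible_Pow[OF inaccessible] U ordLess_imp_ordLeq unfolding small_def by blast
  then obtain \<phi> :: "'u set \<Rightarrow> 'u" where \<phi>: "inj_on \<phi> (Pow U)"
    unfolding card_of_ordLeq[symmetric] by blast
  define \<psi> where "\<psi> = inv_into (Pow U) \<phi>"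
  define I where "I = \<phi> ` {A. A \<subseteq> U \<and> |A| <o \<theta>}"
  define r where "r = {(i, j). i \<in> I \<and> j \<in> I \<and> \<psi> i \<subseteq> \<psi> j}"
  have inv: "\<psi> (\<phi> A) = A" if "A \<subseteq> U" for A using \<phi> that by (simp add: \<psi>_def inv_into_f_f)
  have I: "\<psi> i \<subseteq> U" "|\<psi> i| <o \<theta>" "\<phi> (\<psi> i) = i" if "i \<in> I" for i
    using that inv unfolding I_def by auto
  have "\<psi> ` I = (\<lambda>A. A) ` {A. A \<subseteq> U \<and> |A| <o \<theta>}"
    unfolding I_def image_image by (rule image_cong) (simp_all add: inv)
  then have img: "\<psi> ` I = {A. A \<subseteq> U \<and> |A| <o \<theta>}" by simp
  have "I \<subseteq> \<phi> ` Pow U" unfolding I_def by blast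
  then have "|I| \<le>o |Pow U|"
    by (rule ordLeq_transitive[OF card_of_mono1 card_of_image])
  then have "small I"
    using ordLeq_ordLess_trans[OF _ inaccessible_Pow[OF inaccessible]] U unfolding small_def by blast
  moreover have "antisym r"
  proof (rule antisymI)
    fix i j assume "(i, j) \<in> r" "(j, i) \<in> r"
    then have "i \<in> I" "j \<in> I" "\<psi> i = \<psi> j" unfolding r_def by auto
    then show "i = j" using I(3) by metis
  qed
  then have "partial_order_on I r"
    unfolding partial_order_on_def preorder_on_def by (auto simp: refl_on_def trans_def r_def)
  moreover have "\<exists>u\<in>I. \<forall>x\<in>X. (x, u) \<in> r" if X: "X \<subseteq> I" "|X| <o \<theta>" for X
  proof -
    \<comment> \<open>The upper bound is the union, which stays below \<open>\<theta>\<close> in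
      size by regularity.\<close>
    let ?A = "\<Union>x\<in>X. \<psi> x"
    have "|?A| <o \<theta>" using X I(2) by (intro regular_UN_less[OF \<theta>]) auto
    moreover have AU: "?A \<subseteq> U" using X(1) I(1) by blast
    ultimately have "\<phi> ?A \<in> I" unfolding I_def by (intro imageI) simp
    moreover have "\<psi> x \<subseteq> \<psi> (\<phi> ?A)" if "x \<in> X" for x unfolding inv[OF AU] using that by blast
    ultimately show ?thesis using X(1) unfolding r_def by blast
  qed
  ultimately have "directed_poset \<theta> I r" unfolding directed_poset_def by simp
  then show ?thesis by (rule that[OF _ _ img]) (simp add: r_def)
qed

lemma presentable_imp_generated:
  assumes \<theta>: "regular_cardinal \<theta>" "\<mu> \<le>o \<theta>" and M: "M \<in> models K"
    and pres: "presentable (cat_of K) \<theta> M"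
  shows "generated K \<theta> M"
proof -
  have small: "small (univ M)" using models_structure[OF M] unfolding is_structure_def by blast
  obtain I r \<psi> where dir: "directed_poset \<theta> I r"
    and mono: "\<And>i j. (i, j) \<in> r \<Longrightarrow> \<psi> i \<subseteq> \<psi> j"
    and img: "\<psi> ` I = {A. A \<subseteq> univ M \<and> |A| <o \<theta>}"
    by (rule directed_poset_subsets[OF small \<theta>(1)]) (rule that)
  have \<psi>: "\<psi> i \<subseteq> univ M" "|\<psi> i| <o \<theta>" if "i \<in> I" for i using img that by blast+
  define D where "D i = hull M (\<psi> i)" for i
  have D: "(D i, M) \<in> le K" "univ (D i) = cl K M (\<psi> i)" if "i \<in> I" for i
    unfolding D_def using hull[OF M \<psi>(1)[OF that]] by blast+
  have "(D i, D j) \<in> le K" if "(i, j) \<in> r" for i j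
    unfolding D_def using hull_mono[OF M \<psi>(1) mono] directed_poset_mem[OF dir] that by blast
  then have sys: "directed_system \<mu> K I r D"
    using directed_poset_mono[OF dir \<theta>(2)] D le_models(1) unfolding directed_system_def by blast
  define U where "U = union_struct \<tau> I D"
  note U = directed_union[OF sys, folded U_def]
  have "univ M \<subseteq> univ U"
  proof
    fix x assume x: "x \<in> univ M"
    \<comment> \<open>Singletons have size below \<open>\<theta>\<close>, so the hulls cover
      \<open>M\<close>.\<close>
    have "{x} \<in> \<psi> ` I" unfolding img using x finite_less_regular[OF \<theta>(1), of "{x}"] by simp
    then obtain i where "i \<in> I" "\<psi> i = {x}" by (metis imageE)
    then have "x \<in> univ (D i)" using D(2)[of i] subset_cl[of "{x}" K M] by simp
    then show "x \<in> univ U" using \<open>i \<in> I\<close> unfolding U_def by auto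
  qed
  moreover have UM: "(U, M) \<in> le K" using U(3)[OF M D(1)] .
  ultimately have "U = M" using le_eqI[OF UM le_refl[OF M]] le_univ by blast
  note colim = colimit_directed_union[OF sys, folded U_def, unfolded \<open>U = M\<close>]
  let ?incl = "\<lambda>i. \<lambda>x \<in> univ (D i). x"
  have colim': "colimit set_cat I r (\<lambda>i. hom (cat_of K) M (D i))
      (\<lambda>i j. hom_map (cat_of K) M (D i) (?incl i)) (hom (cat_of K) M M)
      (\<lambda>i. hom_map (cat_of K) M (D i) (?incl i))"
    using pres dir colim unfolding presentable_def by blast
  \<comment> \<open>The hypothesis of a second element in \<open>colimit_set_cat_surj\<close>, for
    the type of morphisms; it holds because \<open>'u\<close> is infinite.\<close>
  have "\<exists>g. g \<noteq> f" for f :: "'u \<Rightarrow> 'u"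
  proof -
    have "infinite (UNIV :: 'u set)"
      using inaccessible unfolding inaccessible_def cinfinite_def by (simp add: Field_card_of)
    then have "UNIV \<noteq> {f undefined}" by (metis finite.intros)
    then obtain y where "y \<noteq> f undefined" by blast
    then have "f(undefined := y) \<noteq> f" by (metis fun_upd_same)
    then show ?thesis by blast
  qed
  \<comment> \<open>The identity of \<open>M\<close> is hit by a leg of the colimit of hom sets,
    that is, it factors through the inclusion of one hull; this hull is all of
    \<open>M\<close>.\<close>
  then obtain i g where i: "i \<in> I" "g \<in> embeddings K M (D i)"
    and id: "(\<lambda>x \<in> univ M. x) = hom_map (cat_of K) M (D i) (?incl i) g"
    using colimit_set_cat_surj[OF colim', of "\<lambda>x \<in> univ M. x"] embedding_inclusion[OF le_refl[OF M]]
    by auto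
  have "univ M \<subseteq> univ (D i)"
  proof
    fix x assume x: "x \<in> univ M"
    have "g x \<in> univ (D i)" using embedding_image[OF i(2)] x by blast
    moreover have "x = ?incl i (g x)"
      using fun_cong[OF id, of x] x i(2) by (simp add: hom_map_def compose_eq)
    ultimately show "x \<in> univ (D i)" by simp
  qed
  then show ?thesis using D(2)[OF i(1)] \<psi>[OF i(1)] unfolding generated_def by blast
qed

section \<open>Ranks and internal sizes\<close>

lemma models_small: "M \<in> models K \<Longrightarrow> small (univ M)"
  using models_structure unfolding is_structure_def by blast

text \<open>The least regular cardinal that is at least \<open>\<mu>\<close> and larger than
  \<open>|A|\<close>. Its being \<open>\<mu>\<close> or a successor is what restricts the possible
  ranks.\<close>

lemma ex_regular_above:
  assumes "small (A :: 'u set)"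
  shows "\<exists>\<sigma> :: 'u rel. regular_cardinal \<sigma> \<and> \<mu> \<le>o \<sigma> \<and> |A| <o \<sigma> \<and> (\<sigma> = \<mu> \<or> \<sigma> =o cardSuc |A| )"
proof (cases "|A| <o \<mu>")
  case True
  moreover have "\<mu> \<le>o \<mu>"
    using regular_mu unfolding regular_cardinal_def cardinal_def card_order_on_def
    by (blast intro: ordLeq_reflexive)
  ultimately show ?thesis using regular_mu by blast
next
  case False
  have \<mu>: "cinfinite \<mu>" "Well_order \<mu>"
    using regular_mu unfolding regular_cardinal_def cardinal_def card_order_on_def by blast+
  have \<mu>A: "\<mu> \<le>o |A|" using False not_ordLess_iff_ordLeq[OF \<mu>(2) card_of_Well_order] by blast
  then have "cinfinite |A|" using \<mu>(1) cinfinite_mono by blast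
  then obtain \<sigma> :: "'u rel" where \<sigma>: "regular_cardinal \<sigma>" "\<sigma> =o cardSuc |A|"
    using ex_cardinal_cardSuc[OF inaccessible, of "|A|"] assms cardinal_card_of by blast
  have "|A| <o \<sigma>"
    using ordLess_ordIso_trans[OF cardSuc_greater[OF card_of_Card_order] ordIso_symmetric[OF \<sigma>(2)]] .
  then show ?thesis using \<sigma> ordLeq_transitive[OF \<mu>A ordLess_imp_ordLeq] by blast
qed

lemma presentable_iff_generated:
  "regular_cardinal \<theta> \<Longrightarrow> \<mu> \<le>o \<theta> \<Longrightarrow> M \<in> models K \<Longrightarrow>
    presentable (cat_of K) \<theta> M \<longleftrightarrow> generated K \<theta> M"
  using generated_imp_presentable presentable_imp_generated by blast

text \<open>A model is generated by its whole universe, so some regular cardinal presents it and the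
  rank has its defining properties.\<close>

lemma rank:
  assumes "M \<in> models K"
  shows "regular_cardinal (presentability_rank (cat_of K) M)"
    and "presentable (cat_of K) (presentability_rank (cat_of K) M) M"
    and "\<And>\<kappa>. regular_cardinal \<kappa> \<Longrightarrow> presentable (cat_of K) \<kappa> M \<Longrightarrow>
      presentability_rank (cat_of K) M \<le>o \<kappa>"
proof -
  obtain \<sigma> :: "'u rel" where "regular_cardinal \<sigma>" "\<mu> \<le>o \<sigma>" "|univ M| <o \<sigma>"
    using ex_regular_above[OF models_small[OF assms]] by blast
  moreover from this have "generated K \<sigma> M"
    unfolding generated_def by (intro exI[of _ "univ M"]) (simp add: subset_cl)
  ultimately have ex: "\<exists>\<theta>. regular_cardinal \<theta> \<and> presentable (cat_of K) \<theta> M"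
    using presentable_iff_generated assms by blast
  show "regular_cardinal (presentability_rank (cat_of K) M)"
    "presentable (cat_of K) (presentability_rank (cat_of K) M) M"
    by (rule presentability_rank[OF ex])+
  show "presentability_rank (cat_of K) M \<le>o \<kappa>"
    if "regular_cardinal \<kappa>" "presentable (cat_of K) \<kappa> M" for \<kappa>
    using that by (rule presentability_rank(3)[OF ex])
qed

text \<open>A set \<open>A\<close> of fewer generators than the rank also bounds the rank by the
  \<open>\<sigma>\<close> that \<open>ex_regular_above\<close> gives for \<open>A\<close>. If this
  is \<open>\<mu>\<close>, the rank is \<open>\<mu>\<close>; otherwise the rank is larger than
  \<open>|A|\<close> and at most its successor.\<close>

lemma rank_successor:
  assumes M: "M \<in> models K" and ge: "\<mu> \<le>o presentability_rank (cat_of K) M"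
  shows "successor_cardinal (presentability_rank (cat_of K) M) \<or> presentability_rank (cat_of K) M =o \<mu>"
proof -
  let ?\<rho> = "presentability_rank (cat_of K) M"
  have "generated K ?\<rho> M" using presentable_imp_generated[OF rank(1)[OF M] ge M rank(2)[OF M]] .
  then obtain A where A: "A \<subseteq> univ M" "|A| <o ?\<rho>" "univ M \<subseteq> cl K M A"
    unfolding generated_def by blast
  have smA: "small A" using small_subset[OF models_small[OF M] A(1)] .
  obtain \<sigma> :: "'u rel" where \<sigma>: "regular_cardinal \<sigma>" "\<mu> \<le>o \<sigma>" "|A| <o \<sigma>"
    "\<sigma> = \<mu> \<or> \<sigma> =o cardSuc |A|"
    using ex_regular_above[OF smA] by blast
  have "generated K \<sigma> M" using A \<sigma>(3) unfolding generated_def by blast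
  then have le: "?\<rho> \<le>o \<sigma>" using rank(3)[OF M \<sigma>(1)] generated_imp_presentable \<sigma>(1,2) by blast
  from \<sigma>(4) show ?thesis
  proof
    assume "\<sigma> = \<mu>"
    then show ?thesis using le ge ordIso_iff_ordLeq by blast
  next
    assume eq: "\<sigma> =o cardSuc |A|"
    have "Card_order ?\<rho>"
      using rank(1)[OF M] unfolding regular_cardinal_def cardinal_def by blast
    then have "cardSuc |A| \<le>o ?\<rho>" using cardSuc_least card_of_Card_order A(2) by blast
    moreover have "?\<rho> \<le>o cardSuc |A|" using le eq by (rule ordLeq_ordIso_trans)
    ultimately have "?\<rho> =o cardSuc |A|" using ordIso_iff_ordLeq by blast
    then show ?thesis using smA cardinal_card_of unfolding successor_cardinal_def by blast
  qed
qed

section \<open>Models of prescribed internal size\<close>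

lemma cl_bound:
  fixes \<theta> :: "'u rel"
  assumes \<theta>: "cardinal \<theta>"
  shows "\<exists>\<kappa> :: 'u rel. cardinal \<kappa> \<and>
    (\<forall>N \<in> models K. \<forall>A \<subseteq> univ N. |A| \<le>o \<theta> \<longrightarrow> |cl K N A| <o \<kappa>)"
proof -
  have "LST_axiom \<mu> K" using mu_AEC unfolding mu_AEC_def by blast
  then obtain \<nu> :: "'u rel" where \<nu>: "cardinal \<nu>"
    and lst: "\<forall>M \<in> models K. \<forall>A \<subseteq> univ M. \<exists>M0 \<in> models K. (M0, M) \<in> le K \<and> A \<subseteq> univ M0 \<and>
      |univ M0| \<le>o power_less |A| \<mu> +c \<nu>"
    unfolding LST_axiom_def by (elim exE conjE) (rule that)
  \<comment> \<open>\<open>?P\<close> bounds \<open>power_less |A| \<mu>\<close> for all relevant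
    \<open>A\<close> at once, \<open>?B\<close> adds the cardinal of the LST axiom, and passing to
    \<open>Pow ?B\<close> makes the bound strict.\<close>
  let ?P = "Field \<mu> \<times> Pow (Field \<mu> \<times> Field \<theta>)"
  let ?B = "?P <+> Field \<nu>"
  note inac = inaccessible
  have \<mu>: "cardinal \<mu>" using regular_mu unfolding regular_cardinal_def by blast
  have fields: "|Field \<mu>| <o |UNIV :: 'u set|" "|Field \<theta>| <o |UNIV :: 'u set|" "|Field \<nu>| <o |UNIV :: 'u set|"
    using small_Field \<mu> \<theta> \<nu> unfolding small_def by blast+
  have "|Field \<mu> \<times> Field \<theta>| <o |UNIV :: 'u set|"
    using inaccessible_Sigma[OF inac fields(1), of "\<lambda>_. Field \<theta>"] fields(2) by simp
  then have "|?P| <o |UNIV :: 'u set|"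
    using inaccessible_Sigma[OF inac fields(1), of "\<lambda>_. Pow (Field \<mu> \<times> Field \<theta>)"]
    by (simp add: inaccessible_Pow[OF inac])
  moreover have "infinite (UNIV :: 'u set)"
    using inac unfolding inaccessible_def cinfinite_def by (simp add: Field_card_of)
  ultimately have "|?B| <o |UNIV :: 'u set|"
    using fields(3) by (intro card_of_Plus_ordLess_infinite)
  then have Pow_B: "|Pow ?B| <o |UNIV :: 'u set|" by (rule inaccessible_Pow[OF inac])
  then obtain S :: "'u set" where S: "|S| =o |Pow ?B|" using ex_card_ordIso by blast
  have "small S"
    using ordIso_ordLess_trans[OF S Pow_B] unfolding small_def .
  moreover have "|cl K N A| <o |S|"
    if N: "N \<in> models K" "A \<subseteq> univ N" "|A| \<le>o \<theta>" for N A
  proof -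
    obtain M0 where M0: "(M0, N) \<in> le K" "A \<subseteq> univ M0" "|univ M0| \<le>o power_less |A| \<mu> +c \<nu>"
      using lst N(1,2) by meson
    have "Card_order \<theta>" using \<theta> unfolding cardinal_def by blast
    then have "|A| \<le>o |Field \<theta>|"
      by (rule ordLeq_ordIso_trans[OF N(3) ordIso_symmetric[OF card_of_Field_ordIso]])
    then have "power_less |A| \<mu> \<le>o |?P|" by (rule power_less_mono_bound)
    then have "power_less |A| \<mu> +c \<nu> \<le>o |?P| +c \<nu>" by (rule csum_mono1)
    then have le: "power_less |A| \<mu> +c \<nu> \<le>o |?B|" unfolding csum_def Field_card_of .
    \<comment> \<open>The closure is contained in every submodel around \<open>A\<close>, in
      particular in the one supplied by the LST axiom.\<close>
    have "|cl K N A| \<le>o |univ M0|" using cl_least[OF M0(1,2)] by (rule card_of_mono1)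
    also note M0(3)
    also note le
    also have "|?B| <o |Pow ?B|" by (rule card_of_Pow)
    also have "|Pow ?B| =o |S|" using S by (rule ordIso_symmetric)
    finally show ?thesis .
  qed
  ultimately show ?thesis using cardinal_card_of by blast
qed

lemma ex_not_generated:
  fixes \<theta> :: "'u rel"
  assumes large: "arbitrarily_large_models K" and \<theta>: "regular_cardinal \<theta>" "\<mu> \<le>o \<theta>"
  shows "\<exists>M \<in> models K. \<not> generated K \<theta> M \<and> (\<exists>A \<subseteq> univ M. |A| \<le>o \<theta> \<and> univ M \<subseteq> cl K M A)"
proof -
  have card\<theta>: "cardinal \<theta>" and co: "Card_order \<theta>" and inf: "infinite (Field \<theta>)"
    using \<theta>(1) unfolding regular_cardinal_def cardinal_def cinfinite_def by blast+
  then have wo: "wo_rel \<theta>" unfolding wo_rel_def card_order_on_def by blast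
  obtain \<kappa> :: "'u rel" where \<kappa>: "cardinal \<kappa>"
    and bound: "\<And>N A. N \<in> models K \<Longrightarrow> A \<subseteq> univ N \<Longrightarrow> |A| \<le>o \<theta> \<Longrightarrow> |cl K N A| <o \<kappa>"
    using cl_bound[OF card\<theta>] by blast
  obtain N where N: "N \<in> models K" "\<kappa> \<le>o |univ N|"
    using large \<kappa> unfolding arbitrarily_large_models_def by blast
  \<comment> \<open>The step of a transfinite recursion: pick a point outside the closure of the
    earlier values. That such a point exists is part of \<open>fresh\<close>.\<close>
  define F where "F = (\<lambda>f \<alpha>. SOME x. x \<in> univ N - cl K N (f ` underS \<theta> \<alpha>))"
  define a where "a = wo_rel.worec \<theta> F"
  have "wo_rel.adm_wo \<theta> F"
    unfolding wo_rel.adm_wo_def[OF wo] F_def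
  proof (intro allI impI)
    fix f g :: "'u \<Rightarrow> 'u" and \<alpha> assume "\<forall>y\<in>underS \<theta> \<alpha>. f y = g y"
    then have "f ` underS \<theta> \<alpha> = g ` underS \<theta> \<alpha>" by auto
    then show "(SOME x. x \<in> univ N - cl K N (f ` underS \<theta> \<alpha>)) =
      (SOME x. x \<in> univ N - cl K N (g ` underS \<theta> \<alpha>))" by simp
  qed
  then have "a = F a" unfolding a_def by (rule wo_rel.worec_fixpoint[OF wo])
  then have a_eq: "a \<alpha> = (SOME x. x \<in> univ N - cl K N (a ` underS \<theta> \<alpha>))" for \<alpha>
    unfolding F_def by (rule fun_cong)
  \<comment> \<open>An induction, because the bound on closures concerns subsets of
    \<open>univ N\<close>: the earlier values must be known to lie in \<open>N\<close> before the
    next choice succeeds.\<close>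
  have fresh: "\<alpha> \<in> Field \<theta> \<longrightarrow> a \<alpha> \<in> univ N - cl K N (a ` underS \<theta> \<alpha>)" for \<alpha>
  proof (induction \<alpha> rule: wo_rel.well_order_induct[OF wo])
    case (1 \<alpha>)
    show ?case
    proof
      assume \<alpha>: "\<alpha> \<in> Field \<theta>"
      have sub: "a ` underS \<theta> \<alpha> \<subseteq> univ N"
        using 1 by (auto simp: underS_def Field_def)
      have "|a ` underS \<theta> \<alpha>| \<le>o |underS \<theta> \<alpha>|" by (rule card_of_image)
      then have "|a ` underS \<theta> \<alpha>| \<le>o \<theta>"
        by (rule ordLess_imp_ordLeq[OF ordLeq_ordLess_trans[OF _ card_underS_less[OF card\<theta> \<alpha>]]])
      then have "|cl K N (a ` underS \<theta> \<alpha>)| <o |univ N|"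
        by (rule ordLess_ordLeq_trans[OF bound[OF N(1) sub] N(2)])
      then have "\<not> univ N \<subseteq> cl K N (a ` underS \<theta> \<alpha>)"
        using card_of_mono1 not_ordLess_ordLeq by blast
      then have "\<exists>x. x \<in> univ N - cl K N (a ` underS \<theta> \<alpha>)" by blast
      then show "a \<alpha> \<in> univ N - cl K N (a ` underS \<theta> \<alpha>)"
        unfolding a_eq[of \<alpha>] by (rule someI_ex)
    qed
  qed
  have aU: "a ` underS \<theta> \<alpha> \<subseteq> univ N" for \<alpha>
    using fresh by (auto simp: underS_def Field_def)
  define D where "D \<alpha> = hull N (a ` underS \<theta> \<alpha>)" for \<alpha>
  have D: "(D \<alpha>, N) \<in> le K" "univ (D \<alpha>) = cl K N (a ` underS \<theta> \<alpha>)" for \<alpha>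
    unfolding D_def using hull[OF N(1) aU] by blast+
  have po: "partial_order_on (Field \<theta>) \<theta>"
    using wo unfolding wo_rel_def well_order_on_def linear_order_on_def by blast
  have D_mono: "(D \<alpha>, D \<beta>) \<in> le K" if "(\<alpha>, \<beta>) \<in> \<theta>" for \<alpha> \<beta>
  proof -
    have "underS \<theta> \<alpha> \<subseteq> underS \<theta> \<beta>"
      using partial_order_onD(2,3)[OF po] that by (rule underS_incr)
    then show ?thesis unfolding D_def by (intro hull_mono[OF N(1) aU] image_mono)
  qed
  have "directed_poset \<theta> (Field \<theta>) \<theta>"
    unfolding directed_poset_def using small_Field[OF card\<theta>] po regular_bounded[OF \<theta>(1)] by blast
  then have sys: "directed_system \<mu> K (Field \<theta>) \<theta> D"
    unfolding directed_system_def
    using directed_poset_mono[OF _ \<theta>(2)] D_mono le_models(1)[OF D(1)] by blast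
  \<comment> \<open>The closure of all \<open>a \<alpha>\<close>, obtained as the union of the
    increasing closures of initial segments, so that each of its elements lies in some
    \<open>D \<alpha>\<close>.\<close>
  define U where "U = union_struct \<tau> (Field \<theta>) D"
  note U = directed_union[OF sys, folded U_def]
  have UN: "(U, N) \<in> le K" using U(3)[OF N(1) D(1)] .
  have aUniv: "a \<alpha> \<in> univ U" if \<alpha>: "\<alpha> \<in> Field \<theta>" for \<alpha>
  proof -
    \<comment> \<open>\<open>D \<alpha>\<close> omits \<open>a \<alpha>\<close>, since
      \<open>underS\<close> excludes \<open>\<alpha>\<close>. An infinite cardinal has no last
      element, so a later stage contains it.\<close>
    obtain \<beta> where \<beta>: "\<beta> \<in> Field \<theta>" "\<alpha> \<noteq> \<beta>" "(\<alpha>, \<beta>) \<in> \<theta>"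
      using infinite_Card_order_limit[OF co inf \<alpha>] by blast
    then have "a \<alpha> \<in> a ` underS \<theta> \<beta>" by (simp add: underS_def)
    then have "a \<alpha> \<in> univ (D \<beta>)" using subset_cl[of "a ` underS \<theta> \<beta>" K N] unfolding D(2) by blast
    then show ?thesis using \<beta>(1) unfolding U_def by auto
  qed
  let ?A = "a ` Field \<theta>"
  have A: "?A \<subseteq> univ U" using aUniv by blast
  have "univ U \<subseteq> cl K U ?A"
  proof -
    have "cl K N (a ` underS \<theta> \<alpha>) \<subseteq> cl K N ?A" for \<alpha>
      by (intro cl_mono image_mono) (auto simp: underS_def Field_def)
    then show ?thesis unfolding cl_submodel[OF UN A] unfolding U_def univ_union_struct D(2) by blast
  qed
  moreover have "|?A| \<le>o \<theta>"
    using card_of_image card_of_Field_ordIso[OF co] by (rule ordLeq_ordIso_trans)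
  moreover have "\<not> generated K \<theta> U"
  proof
    assume "generated K \<theta> U"
    then obtain B where B: "B \<subseteq> univ U" "|B| <o \<theta>" "univ U \<subseteq> cl K U B"
      unfolding generated_def by blast
    have "\<forall>b\<in>B. \<exists>\<alpha>\<in>Field \<theta>. b \<in> univ (D \<alpha>)" using B(1) unfolding U_def by auto
    then obtain k where k: "\<And>b. b \<in> B \<Longrightarrow> k b \<in> Field \<theta> \<and> b \<in> univ (D (k b))" by metis
    have "|k ` B| <o \<theta>" using card_of_image B(2) by (rule ordLeq_ordLess_trans)
    moreover have "k ` B \<subseteq> Field \<theta>" using k by blast
    ultimately obtain \<beta> where \<beta>: "\<beta> \<in> Field \<theta>" "\<forall>x\<in>k ` B. (x, \<beta>) \<in> \<theta>"
      using regular_bounded[OF \<theta>(1)] by blast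
    have "B \<subseteq> univ (D \<beta>)"
    proof
      fix b assume b: "b \<in> B"
      then have "(k b, \<beta>) \<in> \<theta>" using \<beta>(2) by blast
      then show "b \<in> univ (D \<beta>)" using k[OF b] le_univ[OF D_mono] by blast
    qed
    then have "cl K U B \<subseteq> univ (D \<beta>)" using cl_least[OF D(1)] cl_submodel[OF UN B(1)] by simp
    then have "a \<beta> \<in> univ (D \<beta>)" using aUniv[OF \<beta>(1)] B(3) by blast
    then show False using fresh[of \<beta>] \<beta>(1) unfolding D(2) by blast
  qed
  ultimately show ?thesis using U(1) A by blast
qed

lemma ex_internal_size:
  fixes \<theta> :: "'u rel"
  assumes large: "arbitrarily_large_models K" and \<theta>: "regular_cardinal \<theta>" "\<mu> \<le>o \<theta>"
  shows "\<exists>M \<in> models K. internal_size (cat_of K) M =o \<theta>"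
proof -
  obtain M A where M: "M \<in> models K" "\<not> generated K \<theta> M"
    and A: "A \<subseteq> univ M" "|A| \<le>o \<theta>" "univ M \<subseteq> cl K M A"
    using ex_not_generated[OF assms] by blast
  let ?\<rho> = "presentability_rank (cat_of K) M"
  have \<theta>c: "cardinal \<theta>" "cinfinite \<theta>" "Card_order \<theta>" "Well_order \<theta>"
    using \<theta>(1) unfolding regular_cardinal_def cardinal_def card_order_on_def by blast+
  have \<rho>c: "Card_order ?\<rho>" "Well_order ?\<rho>"
    using rank(1)[OF M(1)] unfolding regular_cardinal_def cardinal_def card_order_on_def by blast+
  obtain \<sigma> :: "'u rel" where \<sigma>: "regular_cardinal \<sigma>" "\<sigma> =o cardSuc \<theta>"
    using ex_cardinal_cardSuc[OF inaccessible \<theta>c(1)] \<theta>c(2) by blast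
  have \<theta>\<sigma>: "\<theta> <o \<sigma>"
    using ordLess_ordIso_trans[OF cardSuc_greater[OF \<theta>c(3)] ordIso_symmetric[OF \<sigma>(2)]] .
  have "generated K \<sigma> M"
    using A ordLeq_ordLess_trans[OF A(2) \<theta>\<sigma>] unfolding generated_def by blast
  then have "presentable (cat_of K) \<sigma> M"
    using generated_imp_presentable[OF \<sigma>(1)] ordLeq_transitive[OF \<theta>(2) ordLess_imp_ordLeq[OF \<theta>\<sigma>]] by blast
  then have "?\<rho> \<le>o \<sigma>" by (rule rank(3)[OF M(1) \<sigma>(1)])
  then have "?\<rho> \<le>o cardSuc \<theta>" using \<sigma>(2) by (rule ordLeq_ordIso_trans)
  moreover have "cardSuc \<theta> \<le>o ?\<rho>"
  proof -
    \<comment> \<open>Ranks below \<open>\<mu>\<close>, where presentability is not characterized by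
      generation, are excluded too: \<open>presentable_mono\<close> first lifts them to
      \<open>\<theta>\<close>.\<close>
    have "\<not> ?\<rho> \<le>o \<theta>"
      using presentable_mono[OF rank(2)[OF M(1)]] presentable_imp_generated[OF \<theta> M(1)] M(2) by blast
    then have "\<theta> <o ?\<rho>" using not_ordLeq_iff_ordLess[OF \<theta>c(4) \<rho>c(2)] by blast
    then show ?thesis by (rule cardSuc_least[OF \<theta>c(3) \<rho>c(1)])
  qed
  ultimately have "?\<rho> =o cardSuc \<theta>" using ordIso_iff_ordLeq by blast
  then have "internal_size (cat_of K) M =o \<theta>" by (rule internal_size_successor[OF \<theta>c(1)])
  then show ?thesis using M(1) by blast
qed

end

theorem corollary5p5:
  fixes \<mu> :: "'u rel" and K :: "('s, 'u) aclass"
  assumes "inaccessible |UNIV :: 'u set|"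
    and "regular_cardinal \<mu>"
    and "mu_AEC \<mu> K"
    and "admits_intersections K"
  shows "(\<forall>M \<in> models K. \<mu> \<le>o presentability_rank (cat_of K) M \<longrightarrow>
            successor_cardinal (presentability_rank (cat_of K) M) \<or>
            (presentability_rank (cat_of K) M =o \<mu> \<and> \<not> successor_cardinal \<mu>)) \<and>
         (arbitrarily_large_models K \<longrightarrow>
            (\<forall>\<theta> :: 'u rel. regular_cardinal \<theta> \<and> \<mu> \<le>o \<theta> \<longrightarrow>
               (\<exists>M \<in> models K. internal_size (cat_of K) M =o \<theta>)) \<and>
            weakly_LS_accessible (cat_of K))"
proof -
  interpret muAEC_intersections \<mu> K
    by unfold_locales (fact assms)+
  \<comment> \<open>\<open>rank_successor\<close> leaves the case of rank \<open>\<mu>\<close>. If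
    \<open>\<mu>\<close> is a successor, so is the rank. If not, the case remains: for countable
    \<open>\<mu>\<close> every finitely generated model has rank \<open>\<mu>\<close>.\<close>
  have "successor_cardinal (presentability_rank (cat_of K) M)"
    if "presentability_rank (cat_of K) M =o \<mu>" "successor_cardinal \<mu>" for M
    using that ordIso_transitive unfolding successor_cardinal_def by blast
  \<comment> \<open>\<open>\<mu>\<close> itself serves as the threshold in weak
    LS-accessibility.\<close>
  moreover have "cardinal \<mu>" using assms(2) unfolding regular_cardinal_def by blast
  ultimately show ?thesis
    using rank_successor ex_internal_size unfolding weakly_LS_accessible_def cat_of_simps by blast
qed

end
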